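(* Under the assumption that $A^{ask}=A^{bid}$, there exists a consistent pricing system (CPS) if and only if the no-arbitrage condition under the efficient friction assumption (NAEF) is satisfied.
   Context: Fix a time horizon $T\ge 1$, an integer $N\ge 1$ and a filtered probability space $(\Omega,\mathcal{F}_T,\mathbb{F}=(\mathcal{F}_t)_{t=0}^T,\mathbb{P})$. All equalities and inequalities between random variables/processes are $\mathbb{P}$-a.s. and coordinate-wise. $\Delta X_t:=X_t-X_{t-1}$. Market: a savings account with price process $B_t=\prod_{s=0}^t(1+r_s)$, $t=0,\dots,T$, where $r=(r_t)_{t=0}^T$ is a nonnegative adapted process (the risk-free rate); adapted $\mathbb{R}^N$-valued ex-dividend price processes $P^{ask},P^{bid}$ (indexed by $t=0,\dots,T$) and adapted $\mathbb{R}^N$-valued cumulative dividend processes $A^{ask},A^{bid}$ (indexed by $t=1,\dots,T$, with the convention $A^{ask}_0=A^{bid}_0=0$). Standing Bid-Ask Assumption: $P^{ask}\ge P^{bid}$ and $\Delta A^{ask}\le\Delta A^{bid}$. Discounted processes: $P^{ask,*}=B^{-1}P^{ask}$, $P^{bid,*}=B^{-1}P^{bid}$, $A^{ask,*}=B^{-1}\Delta A^{ask}$, $A^{bid,*}=B^{-1}\Delta A^{bid}$. A trading strategy is an $\mathbb{R}^{N+1}$-valued predictable process $\phi=(\phi^0_t,\phi^1_t,\dots,\phi^N_t)_{t=1}^T$ ($\phi_t$ is $\mathcal{F}_{t-1}$-measurable), with convention $\phi_0=0$. Its value process is $V_0(\phi)=\phi^0_1+\sum_{j=1}^N\phi^j_1(1_{\{\phi^j_1\ge0\}}P^{ask,j}_0+1_{\{\phi^j_1<0\}}P^{bid,j}_0)$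 and, for $1\le t\le T$, $V_t(\phi)=\phi^0_tB_t+\sum_{j=1}^N\phi^j_t(1_{\{\phi^j_t\ge0\}}P^{bid,j}_t+1_{\{\phi^j_t<0\}}P^{ask,j}_t)+\sum_{j=1}^N\phi^j_t(1_{\{\phi^j_t\ge0\}}\Delta A^{ask,j}_t+1_{\{\phi^j_t<0\}}\Delta A^{bid,j}_t)$. $\phi$ is self-financing if for $t=1,\dots,T-1$: $B_t\Delta\phi^0_{t+1}+\sum_{j=1}^N\Delta\phi^j_{t+1}(1_{\{\Delta\phi^j_{t+1}\ge0\}}P^{ask,j}_t+1_{\{\Delta\phi^j_{t+1}<0\}}P^{bid,j}_t)=\sum_{j=1}^N\phi^j_t(1_{\{\phi^j_t\ge0\}}\Delta A^{ask,j}_t+1_{\{\phi^j_t<0\}}\Delta A^{bid,j}_t)$. $\mathcal{S}$ is the set of self-financing trading strategies. The no-arbitrage condition (NA): for each $\phi\in\mathcal{S}$ with $V_0(\phi)=0$ and $V_T(\phi)\ge0$, one has $V_T(\phi)=0$. The efficient friction assumption (EF): $\{\phi\in\mathcal{S}:V_0(\phi)=V_T(\phi)=0\}=\{0\}$. NAEF denotes the no-arbitrage condition under the efficient friction assumption, i.e. NA and EF both hold. $\mathcal{Z}$ is the set of probability measures $\mathbb{Q}$ with $\mathbb{Q}\sim\mathbb{P}$ such that $P^{ask,*},P^{bid,*},A^{ask,*},A^{bid,*}$ are $\mathbb{Q}$-integrable. A consistent pricing system is a quadruplet $\{\mathbb{Q},P,A,M\}$ consisting of a probability measure $\mathbb{Q}\in\mathcal{Z}$;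 an adapted process $P$ with $P^{bid,*}\le P\le P^{ask,*}$; an adapted process $A$ with $A^{ask,*}\le A\le A^{bid,*}$; and a martingale $M$ under $\mathbb{Q}$ with $M_t=P_t+\sum_{u=1}^tA_u$ for all $t\in\{0,\dots,T\}$.
   Formalization: The efficient friction assumption is taken as a standing hypothesis (a CPS does not imply it: take a frictionless constant price), and B_0 = 1, i.e. r_0 = 0, is assumed, since V_0 counts a unit of savings at price 1 and the claim fails otherwise. *)

theory Defs
  imports "HOL-Probability.Probability"
begin

definition increment :: "(nat \<Rightarrow> 'a \<Rightarrow> 'b::minus) \<Rightarrow> nat \<Rightarrow> 'a \<Rightarrow> 'b" where
  "increment X t \<omega> = X t \<omega> - X (t - 1) \<omega>"

text \<open>A long coordinate of the position \<open>x\<close> is evaluated with \<open>p\<close>, a short one with \<open>q\<close>.\<close>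

definition signed_value :: "real ^ 'n \<Rightarrow> real ^ 'n \<Rightarrow> real ^ 'n \<Rightarrow> real" where
  "signed_value x p q = (\<Sum>j\<in>UNIV. x $ j * (if 0 \<le> x $ j then p $ j else q $ j))"

text \<open>
  A vector-valued martingale in discrete time with horizon \<open>T\<close>; the conditional expectation is
  taken coordinate-wise.
\<close>

definition martingale_upto ::
    "'a measure \<Rightarrow> (nat \<Rightarrow> 'a measure) \<Rightarrow> nat \<Rightarrow> (nat \<Rightarrow> 'a \<Rightarrow> real ^ 'n) \<Rightarrow> bool" where
  "martingale_upto Q F T X \<longleftrightarrow>
     (\<forall>t\<le>T. X t \<in> borel_measurable (F t)) \<and>
     (\<forall>t\<le>T. integrable Q (X t)) \<and>
     (\<forall>t\<le>T. \<forall>s\<le>t. \<forall>j.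
        AE \<omega> in Q. real_cond_exp Q (F s) (\<lambda>\<omega>. X t \<omega> $ j) \<omega> = X s \<omega> $ j)"

text \<open>
  Only the times \<open>0, \<dots>, T\<close> matter: processes and sigma-algebras are indexed by all of \<open>nat\<close>, but
  their values beyond \<open>T\<close> never enter (every finite filtration extends to \<open>nat\<close>, constantly
  after \<open>T\<close>). The cumulative dividend processes start at time 1; their value at time 0 is the
  convention that makes \<open>increment\<close> meaningful at time 1.
\<close>

locale dividend_market = prob_space M + filtration "space M" F
  for M :: "'a measure" and F :: "nat \<Rightarrow> 'a measure" +
  fixes T :: nat
    and r :: "nat \<Rightarrow> 'a \<Rightarrow> real"
    and Pask Pbid Aask Abid :: "nat \<Rightarrow> 'a \<Rightarrow> real ^ 'n"
  assumes horizon: "1 \<le> T"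
    and sets_F_horizon: "sets (F T) = sets M"
    and adapted_rate: "t \<le> T \<Longrightarrow> r t \<in> borel_measurable (F t)"
    and rate_nonneg: "t \<le> T \<Longrightarrow> AE \<omega> in M. 0 \<le> r t \<omega>"
    and adapted_Pask: "t \<le> T \<Longrightarrow> Pask t \<in> borel_measurable (F t)"
    and adapted_Pbid: "t \<le> T \<Longrightarrow> Pbid t \<in> borel_measurable (F t)"
    and Aask_0: "Aask 0 \<omega> = 0"
    and Abid_0: "Abid 0 \<omega> = 0"
    and adapted_Aask: "1 \<le> t \<Longrightarrow> t \<le> T \<Longrightarrow> Aask t \<in> borel_measurable (F t)"
    and adapted_Abid: "1 \<le> t \<Longrightarrow> t \<le> T \<Longrightarrow> Abid t \<in> borel_measurable (F t)"
    and bid_le_ask: "t \<le> T \<Longrightarrow> AE \<omega> in M. Pbid t \<omega> \<le> Pask t \<omega>"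
    and dividend_ask_le_bid:
      "1 \<le> t \<Longrightarrow> t \<le> T \<Longrightarrow> AE \<omega> in M. increment Aask t \<omega> \<le> increment Abid t \<omega>"
begin

definition savings :: "nat \<Rightarrow> 'a \<Rightarrow> real" where
  "savings t \<omega> = (\<Prod>s\<le>t. 1 + r s \<omega>)"

definition discounted :: "(nat \<Rightarrow> 'a \<Rightarrow> real ^ 'n) \<Rightarrow> nat \<Rightarrow> 'a \<Rightarrow> real ^ 'n" where
  "discounted X t \<omega> = inverse (savings t \<omega>) *\<^sub>R X t \<omega>"

text \<open>
  \<open>fst (\<phi> t \<omega>)\<close> is the position in the savings account, \<open>snd (\<phi> t \<omega>)\<close> the positions in the
  securities \<open>1, \<dots>, N\<close>, held from \<open>t - 1\<close> to \<open>t\<close>.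
\<close>

definition trading_strategy :: "(nat \<Rightarrow> 'a \<Rightarrow> real \<times> (real ^ 'n)) \<Rightarrow> bool" where
  "trading_strategy \<phi> \<longleftrightarrow>
     (\<forall>\<omega>. \<phi> 0 \<omega> = 0) \<and> (\<forall>t\<in>{1..T}. \<phi> t \<in> borel_measurable (F (t - 1)))"

definition dividend_income :: "(nat \<Rightarrow> 'a \<Rightarrow> real \<times> (real ^ 'n)) \<Rightarrow> nat \<Rightarrow> 'a \<Rightarrow> real" where
  "dividend_income \<phi> t \<omega> =
     signed_value (snd (\<phi> t \<omega>)) (increment Aask t \<omega>) (increment Abid t \<omega>)"

text \<open>
  The initial value counts a unit of the savings account at price 1, that is, it presupposes the
  normalization \<open>savings 0 = 1\<close>; for \<open>t \<ge> 1\<close> it is the liquidation value including the dividends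
  received at \<open>t\<close>.
\<close>

definition value_process :: "(nat \<Rightarrow> 'a \<Rightarrow> real \<times> (real ^ 'n)) \<Rightarrow> nat \<Rightarrow> 'a \<Rightarrow> real" where
  "value_process \<phi> t \<omega> =
     (if t = 0
      then fst (\<phi> 1 \<omega>) + signed_value (snd (\<phi> 1 \<omega>)) (Pask 0 \<omega>) (Pbid 0 \<omega>)
      else fst (\<phi> t \<omega>) * savings t \<omega>
        + signed_value (snd (\<phi> t \<omega>)) (Pbid t \<omega>) (Pask t \<omega>)
        + dividend_income \<phi> t \<omega>)"

definition self_financing :: "(nat \<Rightarrow> 'a \<Rightarrow> real \<times> (real ^ 'n)) \<Rightarrow> bool" where
  "self_financing \<phi> \<longleftrightarrow>
     (\<forall>t\<in>{1..<T}. AE \<omega> in M.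
        savings t \<omega> * fst (increment \<phi> (t + 1) \<omega>)
          + signed_value (snd (increment \<phi> (t + 1) \<omega>)) (Pask t \<omega>) (Pbid t \<omega>)
        = dividend_income \<phi> t \<omega>)"

definition strategies :: "(nat \<Rightarrow> 'a \<Rightarrow> real \<times> (real ^ 'n)) set" where
  "strategies = {\<phi>. trading_strategy \<phi> \<and> self_financing \<phi>}"

definition no_arbitrage :: bool where
  "no_arbitrage \<longleftrightarrow>
     (\<forall>\<phi>\<in>strategies.
        (AE \<omega> in M. value_process \<phi> 0 \<omega> = 0) \<and> (AE \<omega> in M. 0 \<le> value_process \<phi> T \<omega>)
        \<longrightarrow> (AE \<omega> in M. value_process \<phi> T \<omega> = 0))"

text \<open>The right-hand side is \<open>{0}\<close> up to almost sure equality of strategies.\<close>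

definition efficient_friction :: bool where
  "efficient_friction \<longleftrightarrow>
     {\<phi> \<in> strategies. (AE \<omega> in M. value_process \<phi> 0 \<omega> = 0) \<and>
                       (AE \<omega> in M. value_process \<phi> T \<omega> = 0)}
     = {\<phi>. trading_strategy \<phi> \<and> (\<forall>t\<in>{1..T}. AE \<omega> in M. \<phi> t \<omega> = 0)}"

text \<open>
  A consistent pricing system does not imply \<open>efficient_friction\<close>: with one security of constant
  price \<open>Pask = Pbid = 1\<close>, no dividends and zero rate, the position \<open>(-1, 1)\<close> has value zero at
  all times. Hence \<open>efficient_friction\<close> is a standing assumption wherever pricing systems are
  characterized by \<open>NAEF\<close>.
\<close>

definition NAEF :: bool where
  "NAEF \<longleftrightarrow> no_arbitrage \<and> efficient_friction"

definition pricing_measures :: "'a measure set" where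
  "pricing_measures =
     {Q. prob_space Q \<and> sets Q = sets M \<and> absolutely_continuous M Q \<and> absolutely_continuous Q M \<and>
         (\<forall>t\<le>T. integrable Q (discounted Pask t) \<and> integrable Q (discounted Pbid t)) \<and>
         (\<forall>t\<in>{1..T}. integrable Q (discounted (increment Aask) t) \<and>
                     integrable Q (discounted (increment Abid) t))}"

text \<open>The process \<open>A\<close> consists of discounted dividend increments and is indexed by \<open>1, \<dots>, T\<close>.\<close>

definition consistent_pricing_system ::
    "'a measure \<Rightarrow> (nat \<Rightarrow> 'a \<Rightarrow> real ^ 'n) \<Rightarrow> (nat \<Rightarrow> 'a \<Rightarrow> real ^ 'n) \<Rightarrow>
     (nat \<Rightarrow> 'a \<Rightarrow> real ^ 'n) \<Rightarrow> bool" where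
  "consistent_pricing_system Q P A X \<longleftrightarrow>
     Q \<in> pricing_measures \<and>
     (\<forall>t\<le>T. P t \<in> borel_measurable (F t) \<and>
        (AE \<omega> in M. discounted Pbid t \<omega> \<le> P t \<omega> \<and> P t \<omega> \<le> discounted Pask t \<omega>)) \<and>
     (\<forall>t\<in>{1..T}. A t \<in> borel_measurable (F t) \<and>
        (AE \<omega> in M. discounted (increment Aask) t \<omega> \<le> A t \<omega> \<and>
                    A t \<omega> \<le> discounted (increment Abid) t \<omega>)) \<and>
     martingale_upto Q F T X \<and>
     (\<forall>t\<le>T. AE \<omega> in M. X t \<omega> = P t \<omega> + (\<Sum>u=1..t. A u \<omega>))"

end

end

theory Submission
  imports Defs
begin

text \<open>
  Dividends are common, so discounting and reinvesting them reduces the market to one without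
  dividends, with discounted cum-dividend ask and bid prices. Selling a position against these prices
  costs at least its value at any price in between, so the terminal value of a strategy is dominated
  by a martingale transform, and a nonnegative martingale transform vanishes; this is the easy direction.

  Conversely, under NA and EF the cone of portfolios attainable from nothing is closed under
  almost sure convergence: in a sequence of strategies, normalise by \<open>c = max 1 \<bar>\<xi>\<^sub>s\<bar>\<close> for the trade
  \<open>\<xi>\<^sub>s\<close> at the first time \<open>s\<close> and pass to a random subsequence along which \<open>(1/c, \<xi>\<^sub>s/c)\<close> converges;
  if the limit of \<open>1/c\<close> vanishes, the limit is a costless round trip with nonzero first trade, which
  NA and EF exclude. Instead of separating with Hahn-Banach and exhausting, minimise the expectation
  of \<open>u(X\<^sup>0)\<^sup>2 + \<bar>X'\<bar>\<^sup>2\<close> over attainable portfolios \<open>(X\<^sup>0, X')\<close> of cash and securities, where \<open>u\<close> is positive,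
  convex and decreasing. The parallelogram law makes minimising sequences Cauchy, and the negative
  gradient at the minimiser is a separating functional whose cash component is strictly positive.
  That component is the density of the pricing measure, and the martingale closes with the
  quotient of the security components by the cash component.
\<close>

section \<open>Measurable selection of convergent subsequences\<close>

text \<open>Compactness covers the ball by finitely many of the small balls, and one of them must
  catch infinitely many indices. The predicate \<open>P\<close> carries the index set selected so
  far, so that the argument can be iterated.\<close>

lemma bounded_frequently_in_small_ball:
  fixes f :: "nat \<Rightarrow> 'c::euclidean_space" and d :: "nat \<Rightarrow> 'c"
  assumes bounded: "\<And>n. norm (f n) \<le> K" and e: "0 < e"
    and dense: "\<And>x e. 0 < e \<Longrightarrow> \<exists>i. dist x (d i) < e"
    and freq: "\<exists>\<^sub>\<infinity>n. P n"
  shows "\<exists>i. \<exists>\<^sub>\<infinity>n. P n \<and> dist (f n) (d i) < e"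
proof -
  have cover: "cball 0 K \<subseteq> (\<Union>i\<in>UNIV. ball (d i) e)"
    using dense[OF e] by (fastforce simp: dist_commute)
  obtain I where I: "finite I" "cball 0 K \<subseteq> (\<Union>i\<in>I. ball (d i) e)"
    by (rule compactE_image[OF compact_cball _ cover]) auto
  have "\<exists>\<^sub>\<infinity>n. \<exists>i\<in>I. P n \<and> dist (f n) (d i) < e"
  proof (rule INFM_mono[OF freq])
    fix n assume "P n"
    moreover have "f n \<in> cball 0 K" using bounded by simp
    ultimately show "\<exists>i\<in>I. P n \<and> dist (f n) (d i) < e"
      using I(2) by (fastforce simp: dist_commute)
  qed
  then have "\<exists>i\<in>I. \<exists>\<^sub>\<infinity>n. P n \<and> dist (f n) (d i) < e"
    by (rule frequently_bex_finite[OF I(1)])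
  then show ?thesis by blast
qed

text \<open>A measurable Bolzano-Weierstrass theorem. The usual nested selection is run over a
  countable dense set, and every choice is the least admissible natural number, which keeps it
  measurable with respect to \<open>F\<close>.\<close>

lemma random_subsequence:
  fixes f :: "nat \<Rightarrow> 'a \<Rightarrow> 'c::euclidean_space"
  assumes [measurable]: "\<And>n. f n \<in> borel_measurable F"
    and bounded: "\<And>n \<omega>. norm (f n \<omega>) \<le> K"
  obtains \<tau> l where "\<And>k. \<tau> k \<in> measurable F (count_space UNIV)"
    "\<And>\<omega>. strict_mono (\<lambda>k. \<tau> k \<omega>)"
    "\<And>\<omega>. (\<lambda>k. f (\<tau> k \<omega>) \<omega>) \<longlonglongrightarrow> l \<omega>" "l \<in> borel_measurable F"
proof -
  obtain D :: "'c set" where D: "countable D" "\<And>X. open X \<Longrightarrow> X \<noteq> {} \<Longrightarrow> \<exists>d\<in>D. d \<in> X"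
    using countable_dense_setE by metis
  define d where "d = from_nat_into D"
  have "D \<noteq> {}" using D(2)[of UNIV] by auto
  then have range_d: "range d = D"
    using D(1) by (simp add: d_def)
  have dense: "\<exists>i. dist x (d i) < e" if "0 < e" for x e
    using D(2)[of "ball x e"] that range_d by auto
  define idx where "idx A k \<omega> =
      (LEAST i. \<exists>\<^sub>\<infinity>n. A \<omega> n \<and> dist (f n \<omega>) (d i) < (1/2)^k)" for A k \<omega>
  \<comment> \<open>\<open>A k \<omega>\<close> is the infinite index set left after
    \<open>k\<close> selections: for each \<open>j < k\<close> its members have values in one common
    ball of radius \<open>(1/2)^j\<close>.\<close>
  define A where "A = rec_nat (\<lambda>\<omega> n. True)
      (\<lambda>k A \<omega> n. A \<omega> n \<and> dist (f n \<omega>) (d (idx A k \<omega>)) < (1/2)^k)"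
  have A_0: "A 0 \<omega> n" for \<omega> n by (simp add: A_def)
  have A_Suc: "A (Suc k) \<omega> n \<longleftrightarrow> A k \<omega> n \<and> dist (f n \<omega>) (d (idx (A k) k \<omega>)) < (1/2)^k" for k \<omega> n
    by (simp add: A_def)
  have idx_measurable: "idx A k \<in> measurable F (count_space UNIV)"
    if [measurable]: "\<And>n. Measurable.pred F (\<lambda>\<omega>. A \<omega> n)" for A k
    unfolding idx_def INFM_nat by measurable
  have A_measurable[measurable]: "Measurable.pred F (\<lambda>\<omega>. A k \<omega> n)" for k n
  proof (induction k arbitrary: n)
    case 0 show ?case by (simp add: A_0)
  next
    case (Suc k)
    note [measurable] = Suc.IH idx_measurable[of "A k" k, OF Suc.IH]
    have [measurable]: "(\<lambda>\<omega>. d (idx (A k) k \<omega>)) \<in> borel_measurable F"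
      by measurable
    show ?case unfolding A_Suc by measurable
  qed
  have A_freq: "\<exists>\<^sub>\<infinity>n. A k \<omega> n" for k \<omega>
  proof (induction k)
    case 0 show ?case by (simp add: A_0)
  next
    case (Suc k)
    have "\<exists>i. \<exists>\<^sub>\<infinity>n. A k \<omega> n \<and> dist (f n \<omega>) (d i) < (1/2)^k"
      by (rule bounded_frequently_in_small_ball[OF bounded _ dense Suc]) auto
    then show ?case
      unfolding A_Suc idx_def by (rule LeastI_ex)
  qed
  have A_antimono: "A k \<omega> n" if "k \<le> l" "A l \<omega> n" for k l \<omega> n
    using that by (induction rule: dec_induct) (auto simp: A_Suc)
  \<comment> \<open>A diagonal choice: the index at stage \<open>Suc k\<close> lies in
    \<open>A (Suc k)\<close> and beyond the previous index. Since the sets are nested, each of them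
    contains a tail of the subsequence.\<close>
  define \<tau> where "\<tau> = rec_nat (\<lambda>\<omega>. 0) (\<lambda>k t \<omega>. LEAST n. t \<omega> < n \<and> A (Suc k) \<omega> n)"
  have \<tau>_Suc: "\<tau> (Suc k) \<omega> = (LEAST n. \<tau> k \<omega> < n \<and> A (Suc k) \<omega> n)" for k \<omega>
    by (simp add: \<tau>_def)
  have \<tau>: "\<tau> k \<omega> < \<tau> (Suc k) \<omega> \<and> A (Suc k) \<omega> (\<tau> (Suc k) \<omega>)" for k \<omega>
    using LeastI_ex[of "\<lambda>n. \<tau> k \<omega> < n \<and> A (Suc k) \<omega> n"] A_freq[of "Suc k" \<omega>]
    unfolding \<tau>_Suc INFM_nat by blast
  have \<tau>_measurable[measurable]: "\<tau> k \<in> measurable F (count_space UNIV)" for k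
  proof (induction k)
    case 0 show ?case by (simp add: \<tau>_def)
  next
    case (Suc k)
    note [measurable] = Suc
    show ?case unfolding \<tau>_Suc by measurable
  qed
  have \<tau>_mono: "strict_mono (\<lambda>k. \<tau> k \<omega>)" for \<omega>
    using \<tau> by (simp add: strict_mono_Suc_iff)
  have conv: "convergent (\<lambda>k. f (\<tau> k \<omega>) \<omega>)" for \<omega>
  proof -
    have "Cauchy (\<lambda>k. f (\<tau> k \<omega>) \<omega>)"
    proof (rule metric_CauchyI)
      fix e :: real assume "0 < e"
      then obtain k where k: "(1/2::real)^k < e/2"
        using real_arch_pow_inv[of "e/2" "1/2"] by auto
      have "dist (f (\<tau> n \<omega>) \<omega>) (d (idx (A k) k \<omega>)) < e/2" if n: "Suc k \<le> n" for n
      proof -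
        obtain n' where "n = Suc n'" using n by (cases n) auto
        then have "A n \<omega> (\<tau> n \<omega>)" using \<tau> by auto
        then have "A (Suc k) \<omega> (\<tau> n \<omega>)" using A_antimono n by blast
        then show ?thesis using k by (auto simp: A_Suc)
      qed
      then have "dist (f (\<tau> m \<omega>) \<omega>) (f (\<tau> n \<omega>) \<omega>) < e" if "Suc k \<le> m" "Suc k \<le> n" for m n
        using dist_triangle_half_r[of "d (idx (A k) k \<omega>)" "f (\<tau> m \<omega>) \<omega>" e "f (\<tau> n \<omega>) \<omega>"] that
        by (simp add: dist_commute)
      then show "\<exists>N. \<forall>m\<ge>N. \<forall>n\<ge>N. dist (f (\<tau> m \<omega>) \<omega>) (f (\<tau> n \<omega>) \<omega>) < e" by blast
    qed
    then show ?thesis by (simp add: Cauchy_convergent_iff)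
  qed
  define l where "l \<omega> = lim (\<lambda>k. f (\<tau> k \<omega>) \<omega>)" for \<omega>
  have lim: "(\<lambda>k. f (\<tau> k \<omega>) \<omega>) \<longlonglongrightarrow> l \<omega>" for \<omega>
    using conv unfolding l_def by (simp add: convergent_LIMSEQ_iff)
  have "(\<lambda>\<omega>. f (\<tau> k \<omega>) \<omega>) \<in> borel_measurable F" for k
    by measurable
  then have "l \<in> borel_measurable F"
    by (rule borel_measurable_LIMSEQ_metric) (rule lim)
  then show ?thesis
    by (rule that[OF \<tau>_measurable \<tau>_mono lim])
qed

section \<open>Closedness of the cone of attainable portfolios\<close>

text \<open>\<open>H t \<omega> x\<close> is the discounted cash paid for the trade \<open>x\<close>
  at time \<open>t\<close>. The last assumption is the form in which NA and EF enter the closedness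
  argument: a round trip without positive total cost consists of zero trades.\<close>

locale trading_costs = filtration "space M" F
  for M :: "'a measure" and F :: "nat \<Rightarrow> 'a measure" +
  fixes T :: nat and H :: "nat \<Rightarrow> 'a \<Rightarrow> 'b::euclidean_space \<Rightarrow> real"
  assumes sets_F_subset: "t \<le> T \<Longrightarrow> sets (F t) \<subseteq> sets M"
    and H_measurable:
      "t \<le> T \<Longrightarrow> f \<in> borel_measurable (F t) \<Longrightarrow> (\<lambda>\<omega>. H t \<omega> (f \<omega>)) \<in> borel_measurable (F t)"
    and H_continuous: "continuous_on UNIV (H t \<omega>)"
    and H_scale: "0 \<le> c \<Longrightarrow> H t \<omega> (c *\<^sub>R x) = c * H t \<omega> x"
    and H_subadditive: "t \<le> T \<Longrightarrow> AE \<omega> in M. \<forall>x y. H t \<omega> (x + y) \<le> H t \<omega> x + H t \<omega> y"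
    and no_free_round_trip:
      "(\<And>t. t \<le> T \<Longrightarrow> \<xi> t \<in> borel_measurable (F t)) \<Longrightarrow>
       AE \<omega> in M. (\<Sum>t\<le>T. H t \<omega> (\<xi> t \<omega>)) \<le> 0 \<Longrightarrow> AE \<omega> in M. (\<Sum>t\<le>T. \<xi> t \<omega>) = 0 \<Longrightarrow>
       t \<le> T \<Longrightarrow> AE \<omega> in M. \<xi> t \<omega> = 0"
begin

text \<open>Trading \<open>\<xi> t\<close> at each time \<open>t \<ge> s\<close> leads from nothing to at least \<open>fst x\<close> in cash and to
  the position \<open>snd x\<close>.\<close>

definition attains :: "nat \<Rightarrow> (nat \<Rightarrow> 'a \<Rightarrow> 'b) \<Rightarrow> 'a \<Rightarrow> real \<times> 'b \<Rightarrow> bool" where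
  "attains s \<xi> \<omega> x \<longleftrightarrow>
     fst x + (\<Sum>t\<in>{s..T}. H t \<omega> (\<xi> t \<omega>)) \<le> 0 \<and> snd x = (\<Sum>t\<in>{s..T}. \<xi> t \<omega>)"

definition attainable :: "('a \<Rightarrow> real \<times> 'b) set" where
  "attainable = {X \<in> borel_measurable M.
     \<exists>\<xi>. (\<forall>t\<le>T. \<xi> t \<in> borel_measurable (F t)) \<and> (AE \<omega> in M. attains 0 \<xi> \<omega> (X \<omega>))}"

section \<open>Pathwise attainment and its closedness\<close>

lemma H_zero: "H t \<omega> 0 = 0"
  using H_scale[of 0 t \<omega> 0] by simp

lemma H_tendsto: "f \<longlonglongrightarrow> x \<Longrightarrow> (\<lambda>n. H t \<omega> (f n)) \<longlonglongrightarrow> H t \<omega> x"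
  using continuous_on_tendsto_compose[OF H_continuous] by fastforce

text \<open>The claim concerns a single \<omega>, so the factor may depend on \<omega>; this permits
  the random normalisation in \<open>attains_closed_from\<close>.\<close>

lemma attains_scale: "attains s \<xi> \<omega> x \<Longrightarrow> 0 \<le> c \<Longrightarrow> attains s (\<lambda>t \<omega>. c *\<^sub>R \<xi> t \<omega>) \<omega> (c *\<^sub>R x)"
  unfolding attains_def using mult_left_mono[of "fst x + (\<Sum>t\<in>{s..T}. H t \<omega> (\<xi> t \<omega>))" 0 c]
  by (simp add: H_scale scaleR_sum_right sum_distrib_left algebra_simps)

lemma attains_step:
  assumes "s \<le> T"
  shows "attains s \<xi> \<omega> x \<longleftrightarrow>
    attains (Suc s) \<xi> \<omega> (fst x + H s \<omega> (\<xi> s \<omega>), snd x - \<xi> s \<omega>)"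
  using assms unfolding attains_def by (auto simp: sum.atLeast_Suc_atMost algebra_simps)

lemma measurable_F_mono: "f \<in> measurable (F s) N \<Longrightarrow> s \<le> t \<Longrightarrow> f \<in> measurable (F t) N"
  using sets_F_mono[of s t] space_F by (auto simp: measurable_def)

text \<open>Backward induction on the first trading time. The normaliser and the random subsequence
  at time \<open>s\<close> are \<open>F s\<close>-measurable, so later trades stay adapted after
  rescaling and reindexing, and the induction hypothesis applies to what remains once the first
  trade is peeled off.\<close>

lemma attains_closed_from:
  assumes "s \<le> Suc T"
    and "\<And>n t. s \<le> t \<Longrightarrow> t \<le> T \<Longrightarrow> \<xi> n t \<in> borel_measurable (F t)"
    and "AE \<omega> in M. \<forall>n. attains s (\<xi> n) \<omega> (X n \<omega>)"
    and "AE \<omega> in M. (\<lambda>n. X n \<omega>) \<longlonglongrightarrow> Y \<omega>"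
  shows "\<exists>\<eta>. (\<forall>t\<in>{s..T}. \<eta> t \<in> borel_measurable (F t)) \<and> (AE \<omega> in M. attains s \<eta> \<omega> (Y \<omega>))"
  using assms
proof (induction s arbitrary: \<xi> X Y rule: inc_induct)
  case base
  \<comment> \<open>After the horizon both sums are empty, so any strategy serves as witness; what
    is left is that nonpositive cash and zero positions pass to the limit.\<close>
  have "AE \<omega> in M. attains (Suc T) undefined \<omega> (Y \<omega>)"
    using base(2,3)
  proof eventually_elim
    case (elim \<omega>)
    have "fst (Y \<omega>) \<le> 0"
      using elim(1) by (intro LIMSEQ_le_const2[OF tendsto_fst[OF elim(2)]]) (auto simp: attains_def)
    moreover have "snd (Y \<omega>) = 0"
      using elim(1) tendsto_snd[OF elim(2)] by (auto simp: attains_def LIMSEQ_const_iff)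
    ultimately show ?case by (simp add: attains_def)
  qed
  then show ?case by auto
next
  case (step s)
  then have s: "s \<le> T" by simp
  note [measurable] = step.prems(1)[OF order_refl s]
  define c where "c n \<omega> = max 1 (norm (\<xi> n s \<omega>))" for n \<omega>
  have c: "1 \<le> c n \<omega>" "norm (\<xi> n s \<omega>) \<le> c n \<omega>" for n \<omega>
    by (auto simp: c_def)
  \<comment> \<open>Pairing the two normalised quantities lets one random subsequence make both
    converge. Both are bounded by 1 because \<open>c\<close> is at least 1 and at least the size of
    the trade.\<close>
  define u where "u n \<omega> = (1 / c n \<omega>, \<xi> n s \<omega> /\<^sub>R c n \<omega>)" for n \<omega>
  have [measurable]: "c n \<in> borel_measurable (F s)" for n
    unfolding c_def by measurable
  have u_measurable: "u n \<in> borel_measurable (F s)" for n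
    unfolding u_def by measurable
  have u_bounded: "norm (u n \<omega>) \<le> 2" for n \<omega>
  proof -
    have "norm (u n \<omega>) \<le> norm (1 / c n \<omega>) + norm (\<xi> n s \<omega> /\<^sub>R c n \<omega>)"
      unfolding u_def by (rule norm_Pair_le)
    also have "\<dots> \<le> 1 + 1"
      using c[of n \<omega>] by (intro add_mono) (auto simp: field_simps)
    finally show ?thesis by simp
  qed
  obtain \<tau> l where \<tau>: "\<And>k. \<tau> k \<in> measurable (F s) (count_space UNIV)"
      "\<And>\<omega>. strict_mono (\<lambda>k. \<tau> k \<omega>)"
    and l: "\<And>\<omega>. (\<lambda>k. u (\<tau> k \<omega>) \<omega>) \<longlonglongrightarrow> l \<omega>" "l \<in> borel_measurable (F s)"
    by (rule random_subsequence[OF u_measurable u_bounded]) (rule that)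
  define \<alpha> where "\<alpha> \<omega> = fst (l \<omega>)" for \<omega>
  define \<beta> where "\<beta> \<omega> = snd (l \<omega>)" for \<omega>
  have [measurable]: "\<alpha> \<in> borel_measurable (F s)" "\<beta> \<in> borel_measurable (F s)"
    unfolding \<alpha>_def \<beta>_def
    by (auto intro!: measurable_compose[OF l(2)] borel_measurable_continuous_onI continuous_intros)
  have \<alpha>: "(\<lambda>k. 1 / c (\<tau> k \<omega>) \<omega>) \<longlonglongrightarrow> \<alpha> \<omega>" for \<omega>
    using tendsto_fst[OF l(1)] by (simp add: \<alpha>_def u_def)
  have \<beta>: "(\<lambda>k. \<xi> (\<tau> k \<omega>) s \<omega> /\<^sub>R c (\<tau> k \<omega>) \<omega>) \<longlonglongrightarrow> \<beta> \<omega>" for \<omega>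
    using tendsto_snd[OF l(1)] by (simp add: \<beta>_def u_def)
  have \<alpha>_nonneg: "0 \<le> \<alpha> \<omega>" for \<omega>
  proof (rule LIMSEQ_le_const[OF \<alpha>])
    have "0 \<le> 1 / c n \<omega>" for n
      using c(1)[of n \<omega>] by simp
    then show "\<exists>N. \<forall>n\<ge>N. 0 \<le> 1 / c (\<tau> n \<omega>) \<omega>" by (intro exI allI impI)
  qed
  \<comment> \<open>The dichotomy: either the normalisers stay bounded along the subsequence, or the
    limiting first trade has norm exactly 1.\<close>
  have \<alpha>\<beta>: "max (\<alpha> \<omega>) (norm (\<beta> \<omega>)) = 1" for \<omega>
  proof -
    have "max (1 / c n \<omega>) (norm (\<xi> n s \<omega> /\<^sub>R c n \<omega>)) = 1" for n
      unfolding c_def by (auto simp: max_def field_simps)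
    then have "(\<lambda>k. 1) \<longlonglongrightarrow> max (\<alpha> \<omega>) (norm (\<beta> \<omega>))"
      using tendsto_max[OF \<alpha> tendsto_norm[OF \<beta>], of \<omega> \<omega>] by simp
    then show ?thesis by (simp add: LIMSEQ_const_iff)
  qed
  define \<xi>' where "\<xi>' k t \<omega> = \<xi> (\<tau> k \<omega>) t \<omega> /\<^sub>R c (\<tau> k \<omega>) \<omega>" for k t \<omega>
  define X' where "X' k \<omega> = (let x = X (\<tau> k \<omega>) \<omega> /\<^sub>R c (\<tau> k \<omega>) \<omega>
      in (fst x + H s \<omega> (\<xi>' k s \<omega>), snd x - \<xi>' k s \<omega>))" for k \<omega>
  \<comment> \<open>The limit of the normalised targets after the first trade: its cost is charged
    to cash and its position is subtracted.\<close>
  define Y' where "Y' \<omega> = (\<alpha> \<omega> * fst (Y \<omega>) + H s \<omega> (\<beta> \<omega>), \<alpha> \<omega> *\<^sub>R snd (Y \<omega>) - \<beta> \<omega>)" for \<omega>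
  have "\<exists>\<eta>. (\<forall>t\<in>{Suc s..T}. \<eta> t \<in> borel_measurable (F t)) \<and> (AE \<omega> in M. attains (Suc s) \<eta> \<omega> (Y' \<omega>))"
  proof (rule step.IH)
    show "\<xi>' k t \<in> borel_measurable (F t)" if "Suc s \<le> t" "t \<le> T" for k t
    proof -
      have [measurable]: "\<tau> k \<in> measurable (F t) (count_space UNIV)"
        "\<And>n. c n \<in> borel_measurable (F t)" "\<And>n. \<xi> n t \<in> borel_measurable (F t)"
        using that \<tau>(1) step.prems(1) by (auto intro: measurable_F_mono[of _ s])
      show ?thesis unfolding \<xi>'_def by measurable
    qed
    show "AE \<omega> in M. \<forall>k. attains (Suc s) (\<xi>' k) \<omega> (X' k \<omega>)"
      using step.prems(2)
    proof eventually_elim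
      case (elim \<omega>)
      show ?case
      proof
        fix k
        have "attains s (\<lambda>t \<omega>'. (1 / c (\<tau> k \<omega>) \<omega>) *\<^sub>R \<xi> (\<tau> k \<omega>) t \<omega>') \<omega>
            ((1 / c (\<tau> k \<omega>) \<omega>) *\<^sub>R X (\<tau> k \<omega>) \<omega>)"
          using elim c(1)[of "\<tau> k \<omega>" \<omega>] by (intro attains_scale) auto
        then have "attains s (\<xi>' k) \<omega> (X (\<tau> k \<omega>) \<omega> /\<^sub>R c (\<tau> k \<omega>) \<omega>)"
          by (simp add: attains_def \<xi>'_def inverse_eq_divide)
        then show "attains (Suc s) (\<xi>' k) \<omega> (X' k \<omega>)"
          using s by (simp add: attains_step X'_def Let_def)
      qed
    qed
    show "AE \<omega> in M. (\<lambda>k. X' k \<omega>) \<longlonglongrightarrow> Y' \<omega>"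
      using step.prems(3)
    proof eventually_elim
      case (elim \<omega>)
      have "(\<lambda>k. X (\<tau> k \<omega>) \<omega>) \<longlonglongrightarrow> Y \<omega>"
        using LIMSEQ_subseq_LIMSEQ[OF elim \<tau>(2)] by (simp add: o_def)
      then have x: "(\<lambda>k. X (\<tau> k \<omega>) \<omega> /\<^sub>R c (\<tau> k \<omega>) \<omega>) \<longlonglongrightarrow> \<alpha> \<omega> *\<^sub>R Y \<omega>"
        using tendsto_scaleR[OF \<alpha>] by (simp add: inverse_eq_divide)
      have "(\<lambda>k. \<xi>' k s \<omega>) \<longlonglongrightarrow> \<beta> \<omega>"
        using \<beta> by (simp add: \<xi>'_def)
      then show ?case
        unfolding X'_def Y'_def Let_def
        using tendsto_fst[OF x] tendsto_snd[OF x] H_tendsto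
        by (intro tendsto_Pair tendsto_add tendsto_diff) auto
    qed
  qed
  then obtain \<eta>' where \<eta>': "\<forall>t\<in>{Suc s..T}. \<eta>' t \<in> borel_measurable (F t)"
      "AE \<omega> in M. attains (Suc s) \<eta>' \<omega> (Y' \<omega>)"
    by auto
  define \<eta> where "\<eta> t = (if t = s then \<beta> else \<eta>' t)" for t
  have \<eta>_measurable[measurable]: "\<eta> t \<in> borel_measurable (F t)" if "s \<le> t" "t \<le> T" for t
    using \<eta>'(1) that by (auto simp: \<eta>_def)
  have \<eta>: "AE \<omega> in M. attains s \<eta> \<omega> (\<alpha> \<omega> *\<^sub>R Y \<omega>)"
    using \<eta>'(2)
  proof eventually_elim
    case (elim \<omega>)
    then show ?case
      unfolding attains_step[OF s] by (simp add: attains_def \<eta>_def Y'_def)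
  qed
  \<comment> \<open>Where \<open>\<alpha>\<close> vanishes, the target
    \<open>\<alpha> \<omega> *\<^sub>R Y \<omega>\<close> is zero, so \<open>\<eta>\<close> is a
    round trip at no cost there. Restricting to this event keeps the trades adapted because it
    belongs to \<open>F s\<close> and all trades before \<open>s\<close> are zero.\<close>
  define \<zeta> where "\<zeta> t \<omega> = (if s \<le> t \<and> \<alpha> \<omega> = 0 then \<eta> t \<omega> else 0)" for t \<omega>
  have \<zeta>_sum: "(\<Sum>t\<le>T. g t (\<zeta> t \<omega>)) = (if \<alpha> \<omega> = 0 then \<Sum>t\<in>{s..T}. g t (\<eta> t \<omega>) else 0)"
    if "\<And>t. g t 0 = 0" for \<omega> and g :: "nat \<Rightarrow> 'b \<Rightarrow> 'c::comm_monoid_add"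
    using that unfolding \<zeta>_def by (auto intro!: sum.mono_neutral_cong_right)
  have "AE \<omega> in M. \<zeta> s \<omega> = 0"
  proof (rule no_free_round_trip)
    show "\<zeta> t \<in> borel_measurable (F t)" if "t \<le> T" for t
    proof (cases "s \<le> t")
      case True
      note [measurable] = \<eta>_measurable[OF True that]
      have [measurable]: "\<alpha> \<in> borel_measurable (F t)"
        using True by (auto intro: measurable_F_mono[of _ s])
      show ?thesis using True unfolding \<zeta>_def by measurable
    next
      case False
      then have "\<zeta> t = (\<lambda>\<omega>. 0)" by (simp add: \<zeta>_def fun_eq_iff)
      then show ?thesis by simp
    qed
    show "AE \<omega> in M. (\<Sum>t\<le>T. H t \<omega> (\<zeta> t \<omega>)) \<le> 0"
      using \<eta> by eventually_elim (auto simp: \<zeta>_sum[of "\<lambda>t. H t _"] H_zero attains_def)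
    show "AE \<omega> in M. (\<Sum>t\<le>T. \<zeta> t \<omega>) = 0"
      using \<eta> by eventually_elim (auto simp: \<zeta>_sum[of "\<lambda>t x. x"] attains_def)
  qed (rule s)
  \<comment> \<open>The first trade of the round trip is \<open>\<beta>\<close>; its vanishing on
    the event \<open>\<alpha> \<omega> = 0\<close> contradicts
    \<open>\<alpha>\<beta>\<close>.\<close>
  then have \<alpha>_pos: "AE \<omega> in M. 0 < \<alpha> \<omega>"
  proof eventually_elim
    case (elim \<omega>)
    then show ?case
      using \<alpha>\<beta>[of \<omega>] \<alpha>_nonneg[of \<omega>] by (auto simp: \<zeta>_def \<eta>_def less_le)
  qed
  \<comment> \<open>Undoing the normalisation: the divisor is \<open>F s\<close>-measurable, hence
    so are the divided trades at their own times.\<close>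
  have "AE \<omega> in M. attains s (\<lambda>t \<omega>. \<eta> t \<omega> /\<^sub>R \<alpha> \<omega>) \<omega> (Y \<omega>)"
    using \<eta> \<alpha>_pos
  proof eventually_elim
    case (elim \<omega>)
    then show ?case
      using attains_scale[of s \<eta> \<omega> "\<alpha> \<omega> *\<^sub>R Y \<omega>" "inverse (\<alpha> \<omega>)"] by (simp add: attains_def)
  qed
  moreover have "(\<lambda>\<omega>. \<eta> t \<omega> /\<^sub>R \<alpha> \<omega>) \<in> borel_measurable (F t)" if "t \<in> {s..T}" for t
  proof -
    have [measurable]: "\<alpha> \<in> borel_measurable (F t)" "\<eta> t \<in> borel_measurable (F t)"
      using that by (auto intro: measurable_F_mono[of _ s])
    show ?thesis by measurable
  qed
  ultimately show ?case by (intro exI[of _ "\<lambda>t \<omega>. \<eta> t \<omega> /\<^sub>R \<alpha> \<omega>"]) auto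
qed

lemma attainable_closed:
  assumes "\<And>n. X n \<in> attainable" and [measurable]: "Y \<in> borel_measurable M"
    and "AE \<omega> in M. (\<lambda>n. X n \<omega>) \<longlonglongrightarrow> Y \<omega>"
  shows "Y \<in> attainable"
proof -
  obtain \<xi> where \<xi>: "\<And>n t. t \<le> T \<Longrightarrow> \<xi> n t \<in> borel_measurable (F t)"
    "\<And>n. AE \<omega> in M. attains 0 (\<xi> n) \<omega> (X n \<omega>)"
    using assms(1) unfolding attainable_def mem_Collect_eq by metis
  have "AE \<omega> in M. \<forall>n. attains 0 (\<xi> n) \<omega> (X n \<omega>)"
    using \<xi>(2) by (simp add: AE_all_countable)
  from attains_closed_from[OF _ \<xi>(1) this assms(3)]
  obtain \<eta> where "\<forall>t\<in>{0..T}. \<eta> t \<in> borel_measurable (F t)" "AE \<omega> in M. attains 0 \<eta> \<omega> (Y \<omega>)"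
    by auto
  then show ?thesis
    using assms(2) by (auto simp: attainable_def intro!: exI[of _ \<eta>])
qed

section \<open>Cone structure of the attainable portfolios\<close>

lemma attainable_scale:
  assumes "X \<in> attainable" "0 \<le> c"
  shows "(\<lambda>\<omega>. c *\<^sub>R X \<omega>) \<in> attainable"
proof -
  obtain \<xi> where X: "X \<in> borel_measurable M"
    and \<xi>: "\<And>t. t \<le> T \<Longrightarrow> \<xi> t \<in> borel_measurable (F t)" "AE \<omega> in M. attains 0 \<xi> \<omega> (X \<omega>)"
    using assms(1) unfolding attainable_def by blast
  have "AE \<omega> in M. attains 0 (\<lambda>t \<omega>. c *\<^sub>R \<xi> t \<omega>) \<omega> (c *\<^sub>R X \<omega>)"
    using \<xi>(2) by eventually_elim (rule attains_scale[OF _ assms(2)])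
  moreover have "(\<lambda>\<omega>. c *\<^sub>R \<xi> t \<omega>) \<in> borel_measurable (F t)" if "t \<le> T" for t
    using \<xi>(1)[OF that] by measurable
  ultimately show ?thesis
    using X unfolding attainable_def by (auto intro!: exI[of _ "\<lambda>t \<omega>. c *\<^sub>R \<xi> t \<omega>"])
qed

lemma attainable_add:
  assumes "X \<in> attainable" "Y \<in> attainable"
  shows "(\<lambda>\<omega>. X \<omega> + Y \<omega>) \<in> attainable"
proof -
  obtain \<xi> where X: "X \<in> borel_measurable M"
    and \<xi>: "\<And>t. t \<le> T \<Longrightarrow> \<xi> t \<in> borel_measurable (F t)" "AE \<omega> in M. attains 0 \<xi> \<omega> (X \<omega>)"
    using assms(1) unfolding attainable_def by blast
  obtain \<eta> where Y: "Y \<in> borel_measurable M"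
    and \<eta>: "\<And>t. t \<le> T \<Longrightarrow> \<eta> t \<in> borel_measurable (F t)" "AE \<omega> in M. attains 0 \<eta> \<omega> (Y \<omega>)"
    using assms(2) unfolding attainable_def by blast
  have "AE \<omega> in M. \<forall>t\<in>{0..T}. \<forall>x y. H t \<omega> (x + y) \<le> H t \<omega> x + H t \<omega> y"
    using H_subadditive by (intro AE_finite_allI) auto
  with \<xi>(2) \<eta>(2) have "AE \<omega> in M. attains 0 (\<lambda>t \<omega>. \<xi> t \<omega> + \<eta> t \<omega>) \<omega> (X \<omega> + Y \<omega>)"
  proof eventually_elim
    case (elim \<omega>)
    have "(\<Sum>t\<in>{0..T}. H t \<omega> (\<xi> t \<omega> + \<eta> t \<omega>))
        \<le> (\<Sum>t\<in>{0..T}. H t \<omega> (\<xi> t \<omega>)) + (\<Sum>t\<in>{0..T}. H t \<omega> (\<eta> t \<omega>))"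
      unfolding sum.distrib[symmetric] using elim(3) by (intro sum_mono) auto
    then show ?case
      using elim(1,2) by (auto simp: attains_def sum.distrib)
  qed
  moreover have "(\<lambda>\<omega>. \<xi> t \<omega> + \<eta> t \<omega>) \<in> borel_measurable (F t)" if "t \<le> T" for t
    using \<xi>(1)[OF that] \<eta>(1)[OF that] by measurable
  ultimately show ?thesis
    using X Y unfolding attainable_def by (auto intro!: exI[of _ "\<lambda>t \<omega>. \<xi> t \<omega> + \<eta> t \<omega>"])
qed

lemma attainable_mono:
  assumes "X \<in> attainable" "Y \<in> borel_measurable M"
    and "AE \<omega> in M. fst (Y \<omega>) \<le> fst (X \<omega>) \<and> snd (Y \<omega>) = snd (X \<omega>)"
  shows "Y \<in> attainable"
proof -
  obtain \<xi> where \<xi>: "\<And>t. t \<le> T \<Longrightarrow> \<xi> t \<in> borel_measurable (F t)" "AE \<omega> in M. attains 0 \<xi> \<omega> (X \<omega>)"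
    using assms(1) unfolding attainable_def by blast
  have "AE \<omega> in M. attains 0 \<xi> \<omega> (Y \<omega>)"
    using \<xi>(2) assms(3) by eventually_elim (auto simp: attains_def)
  then show ?thesis
    using \<xi>(1) assms(2) unfolding attainable_def by blast
qed

text \<open>These portfolios, with a single trade at one time, are the test elements from which the
  bid and ask bounds of the pricing system are read off.\<close>

lemma attainable_trade:
  assumes t: "t \<le> T" and f: "f \<in> borel_measurable (F t)"
  shows "(\<lambda>\<omega>. (- H t \<omega> (f \<omega>), f \<omega>)) \<in> attainable"
proof -
  define \<xi> where "\<xi> u = (if u = t then f else (\<lambda>\<omega>. 0))" for u
  have "(\<lambda>\<omega>. H t \<omega> (f \<omega>)) \<in> borel_measurable (F t)"
    using H_measurable[OF t f] .
  moreover have "g \<in> borel_measurable (F t) \<Longrightarrow> g \<in> borel_measurable M" for g :: "'a \<Rightarrow> 'c::topological_space"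
    using sets_F_subset[OF t] space_F by (auto simp: measurable_def)
  ultimately have [measurable]: "(\<lambda>\<omega>. H t \<omega> (f \<omega>)) \<in> borel_measurable M" "f \<in> borel_measurable M"
    using f by blast+
  have sum_single: "(\<Sum>u\<in>{0..T}. g u (\<xi> u \<omega>)) = g t (f \<omega>)" if "\<And>u. g u 0 = 0"
    for g :: "nat \<Rightarrow> 'b \<Rightarrow> 'd::comm_monoid_add" and \<omega>
  proof -
    have "(\<Sum>u\<in>{0..T}. g u (\<xi> u \<omega>)) = (\<Sum>u\<in>{0..T}. if u = t then g t (f \<omega>) else 0)"
      using that by (intro sum.cong) (auto simp: \<xi>_def)
    then show ?thesis using t by simp
  qed
  then have "attains 0 \<xi> \<omega> (- H t \<omega> (f \<omega>), f \<omega>)" for \<omega>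
    unfolding attains_def by (simp add: sum_single[of "\<lambda>u. H u \<omega>"] sum_single[of "\<lambda>u x. x"] H_zero)
  moreover have "\<xi> u \<in> borel_measurable (F u)" for u
    using f by (simp add: \<xi>_def)
  ultimately show ?thesis
    unfolding attainable_def by (auto intro!: exI[of _ \<xi>])
qed

text \<open>Attaining nonnegative cash and no position is a round trip at no cost, so all trades
  vanish almost surely and cannot have produced the cash.\<close>

lemma attainable_cash_null:
  assumes A: "A \<in> sets M" and "(\<lambda>\<omega>. (indicator A \<omega>, 0)) \<in> attainable"
  shows "A \<in> null_sets M"
proof -
  obtain \<xi> where \<xi>: "\<And>t. t \<le> T \<Longrightarrow> \<xi> t \<in> borel_measurable (F t)"
    and at: "AE \<omega> in M. attains 0 \<xi> \<omega> (indicator A \<omega>, 0)"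
    using assms(2) unfolding attainable_def by blast
  have "AE \<omega> in M. \<xi> t \<omega> = 0" if "t \<le> T" for t
  proof (rule no_free_round_trip[OF \<xi> _ _ that])
    show "AE \<omega> in M. (\<Sum>t\<le>T. H t \<omega> (\<xi> t \<omega>)) \<le> 0"
      using at
    proof eventually_elim
      case (elim \<omega>)
      have "(0::real) \<le> indicator A \<omega>" by simp
      then show ?case using elim unfolding attains_def atMost_atLeast0 fst_conv by linarith
    qed
    show "AE \<omega> in M. (\<Sum>t\<le>T. \<xi> t \<omega>) = 0"
      using at by eventually_elim (simp add: attains_def atMost_atLeast0)
  qed
  then have "AE \<omega> in M. \<forall>t\<in>{0..T}. \<xi> t \<omega> = 0"
    by (intro AE_finite_allI) auto
  with at have "AE \<omega> in M. \<omega> \<notin> A"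
  proof eventually_elim
    case (elim \<omega>)
    then have "indicator A \<omega> \<le> (0::real)"
      by (simp add: attains_def H_zero)
    then show ?case by (auto simp: indicator_def split: if_splits)
  qed
  then show ?thesis using A by (simp add: AE_iff_null_sets)
qed

end

section \<open>A strictly positive separating density\<close>

text \<open>A choice that grows only linearly, so bounded cash has finite penalty, and that has the
  elementary inverse \<open>(1 / u - u) / 2\<close> on the positive reals.\<close>

definition disutility :: "real \<Rightarrow> real" where
  "disutility x = sqrt (1 + x\<^sup>2) - x"

lemma abs_less_sqrt: "\<bar>x\<bar> < sqrt (1 + x\<^sup>2)"
  by (rule real_less_rsqrt) simp

lemma disutility_pos: "0 < disutility x"
  using abs_less_sqrt[of x] by (simp add: disutility_def)

lemma disutility_le: "disutility x \<le> 2 * sqrt (1 + x\<^sup>2)"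
  using abs_less_sqrt[of x] by (simp add: disutility_def)

lemma disutility_continuous: "continuous_on S disutility"
  unfolding disutility_def by (intro continuous_intros)

text \<open>Convexity of the square root term is the triangle inequality in the plane for the
  vectors (1, x) and (1, y).\<close>

lemma disutility_midpoint: "disutility ((x + y) / 2) \<le> (disutility x + disutility y) / 2"
proof -
  have "2 * sqrt (1 + ((x + y) / 2)\<^sup>2) = sqrt (4 * (1 + ((x + y) / 2)\<^sup>2))"
    by (subst real_sqrt_mult) simp
  also have "\<dots> = sqrt ((1 + 1)\<^sup>2 + (x + y)\<^sup>2)"
    by (simp add: power_divide)
  also have "\<dots> \<le> sqrt (1\<^sup>2 + x\<^sup>2) + sqrt (1\<^sup>2 + y\<^sup>2)"
    by (rule real_sqrt_sum_squares_triangle_ineq)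
  finally show ?thesis by (simp add: disutility_def field_simps)
qed

text \<open>Recovers cash from its penalty; convergence of penalties to a positive limit thus
  becomes convergence of cash.\<close>

lemma disutility_inverse: "(1 / disutility x - disutility x) / 2 = x"
proof -
  have "disutility x * (sqrt (1 + x\<^sup>2) + x) = 1"
    by (simp add: disutility_def algebra_simps power2_eq_square)
  then have "1 / disutility x = sqrt (1 + x\<^sup>2) + x"
    using disutility_pos[of x] by (simp add: field_simps)
  then show ?thesis by (simp add: disutility_def)
qed

lemma disutility_of_inverse:
  assumes "0 < U"
  shows "disutility ((1 / U - U) / 2) = U"
proof -
  have "1 + ((1 / U - U) / 2)\<^sup>2 = ((1 / U + U) / 2)\<^sup>2"
    using assms by (simp add: field_simps power2_eq_square)
  then have "sqrt (1 + ((1 / U - U) / 2)\<^sup>2) = (1 / U + U) / 2"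
    using assms by simp
  then show ?thesis by (simp add: disutility_def field_simps)
qed

text \<open>The second-order upper expansion needed to differentiate the cost at its minimiser. The
  slope at \<open>x\<close> is \<open>- disutility x / sqrt (1 + x\<^sup>2)\<close>.\<close>

lemma disutility_add_le:
  "disutility (x + h) \<le> disutility x - h * disutility x / sqrt (1 + x\<^sup>2) + h\<^sup>2 / 2"
proof -
  define s where "s = sqrt (1 + x\<^sup>2)"
  have s: "1 \<le> s" "s\<^sup>2 = 1 + x\<^sup>2" by (auto simp: s_def)
  have "sqrt (1 + (x + h)\<^sup>2) \<le> s + x * h / s + h\<^sup>2 / (2 * s)"
  proof (rule real_le_lsqrt)
    \<comment> \<open>The square root is bounded by its tangent at \<open>s\<^sup>2\<close>: the
      increment of the radicand equals \<open>2 * s * y\<close> for the proposed \<open>y\<close>,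
      and completing the square adds only the nonnegative \<open>y\<^sup>2\<close>.\<close>
    have square: "s\<^sup>2 + 2 * s * y \<le> (s + y)\<^sup>2" for y
      by (simp add: power2_sum)
    have "1 + (x + h)\<^sup>2 = s\<^sup>2 + 2 * s * (x * h / s + h\<^sup>2 / (2 * s))"
      using s by (simp add: field_simps power2_eq_square)
    also have "\<dots> \<le> (s + (x * h / s + h\<^sup>2 / (2 * s)))\<^sup>2"
      by (rule square)
    finally show "1 + (x + h)\<^sup>2 \<le> (s + x * h / s + h\<^sup>2 / (2 * s))\<^sup>2"
      by (simp add: add.assoc)
    have "0 \<le> (s\<^sup>2 + (s\<^sup>2 + 2 * x * h + h\<^sup>2)) / (2 * s)"
    proof -
      have "s\<^sup>2 + 2 * x * h + h\<^sup>2 = 1 + (x + h)\<^sup>2"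
        by (simp add: s(2) power2_sum)
      then show ?thesis using s(1) by simp
    qed
    also have "\<dots> = s + x * h / s + h\<^sup>2 / (2 * s)"
      using s(1) by (simp add: field_simps power2_eq_square)
    finally show "0 \<le> s + x * h / s + h\<^sup>2 / (2 * s)" .
  qed
  also have "h\<^sup>2 / (2 * s) \<le> h\<^sup>2 / 2"
    using s(1) by (intro divide_left_mono) auto
  finally have "sqrt (1 + (x + h)\<^sup>2) \<le> s + x * h / s + h\<^sup>2 / 2" by simp
  moreover have "h * (s - x) / s = h - x * h / s"
    using s(1) by (simp add: field_simps)
  ultimately show ?thesis by (simp add: disutility_def flip: s_def)
qed

section \<open>Convexity of the squared penalty\<close>

definition penalty :: "real \<times> 'b::real_inner \<Rightarrow> real \<times> 'b" where
  "penalty x = (disutility (fst x), snd x)"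

lemma norm_penalty: "(norm (penalty x))\<^sup>2 = (disutility (fst x))\<^sup>2 + (norm (snd x))\<^sup>2"
  by (simp add: penalty_def norm_Pair)

lemma penalty_measurable:
  "(penalty :: real \<times> 'b::euclidean_space \<Rightarrow> _) \<in> borel_measurable borel"
  unfolding penalty_def
  by (intro borel_measurable_continuous_onI continuous_intros
      continuous_on_compose2[OF disutility_continuous[of UNIV]]) auto

text \<open>Although \<open>penalty\<close> is not linear, its cash component at the midpoint is
  positive and at most the average, so its square is too. The parallelogram law for the averaged
  penalties then gives the quantitative gap.\<close>

lemma penalty_midpoint:
  "(norm (penalty ((1/2) *\<^sub>R (x + y))))\<^sup>2
    \<le> ((norm (penalty x))\<^sup>2 + (norm (penalty y))\<^sup>2) / 2 - (norm (penalty x - penalty y))\<^sup>2 / 4"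
proof -
  have "(disutility (fst ((1/2) *\<^sub>R (x + y))))\<^sup>2 \<le> ((disutility (fst x) + disutility (fst y)) / 2)\<^sup>2"
    using disutility_midpoint[of "fst x" "fst y"] disutility_pos
    by (intro power_mono) (auto simp: less_imp_le)
  then have "(norm (penalty ((1/2) *\<^sub>R (x + y))))\<^sup>2 \<le> (norm ((1/2) *\<^sub>R (penalty x + penalty y)))\<^sup>2"
    by (simp add: norm_penalty) (simp add: penalty_def norm_Pair power_divide power_mult_distrib)
  also have "\<dots> = ((norm (penalty x))\<^sup>2 + (norm (penalty y))\<^sup>2) / 2 - (norm (penalty x - penalty y))\<^sup>2 / 4"
    by (simp add: power2_norm_eq_inner inner_add inner_diff inner_commute field_simps)
  finally show ?thesis .
qed

text \<open>Abstracts the attainable portfolios. Free disposal, \<open>C_mono\<close>, concerns cash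
  only, and \<open>C_closed\<close> asks for closedness under almost everywhere convergence, so the
  cone can be transferred to an equivalent finite measure.\<close>

locale closed_solid_cone = finite_measure N for N :: "'a measure" +
  fixes C :: "('a \<Rightarrow> real \<times> 'b::euclidean_space) set"
  assumes C_measurable: "X \<in> C \<Longrightarrow> X \<in> borel_measurable N"
    and C_scale: "X \<in> C \<Longrightarrow> 0 \<le> c \<Longrightarrow> (\<lambda>\<omega>. c *\<^sub>R X \<omega>) \<in> C"
    and C_add: "X \<in> C \<Longrightarrow> Y \<in> C \<Longrightarrow> (\<lambda>\<omega>. X \<omega> + Y \<omega>) \<in> C"
    and C_mono: "X \<in> C \<Longrightarrow> Y \<in> borel_measurable N \<Longrightarrow>
      AE \<omega> in N. fst (Y \<omega>) \<le> fst (X \<omega>) \<and> snd (Y \<omega>) = snd (X \<omega>) \<Longrightarrow> Y \<in> C"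
    and C_closed: "(\<And>n. Z n \<in> C) \<Longrightarrow> Y \<in> borel_measurable N \<Longrightarrow>
      AE \<omega> in N. (\<lambda>n. Z n \<omega>) \<longlonglongrightarrow> Y \<omega> \<Longrightarrow> Y \<in> C"
    and C_cash_null: "A \<in> sets N \<Longrightarrow> (\<lambda>\<omega>. (indicator A \<omega>, 0)) \<in> C \<Longrightarrow> A \<in> null_sets N"
    and C_zero: "(\<lambda>\<omega>. 0) \<in> C"
begin

definition cost :: "('a \<Rightarrow> real \<times> 'b) \<Rightarrow> real" where
  "cost X = (LINT \<omega>|N. (norm (penalty (X \<omega>)))\<^sup>2)"

definition C2 :: "('a \<Rightarrow> real \<times> 'b) set" where
  "C2 = {X \<in> C. integrable N (\<lambda>\<omega>. (norm (penalty (X \<omega>)))\<^sup>2)}"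

lemma penalty_borel[measurable (raw)]:
  fixes X :: "'a \<Rightarrow> real \<times> 'b"
  shows "X \<in> borel_measurable N \<Longrightarrow> (\<lambda>\<omega>. penalty (X \<omega>)) \<in> borel_measurable N"
  by (rule measurable_compose[OF _ penalty_measurable])

lemma integrable_of_norm_square:
  fixes f :: "'a \<Rightarrow> 'c::{banach, second_countable_topology}"
  assumes [measurable]: "f \<in> borel_measurable N" and "integrable N (\<lambda>\<omega>. (norm (f \<omega>))\<^sup>2)"
  shows "integrable N f"
proof (rule Bochner_Integration.integrable_bound)
  show "integrable N (\<lambda>\<omega>. 1 + (norm (f \<omega>))\<^sup>2)" using assms(2) by simp
  have "norm x \<le> norm (1 + (norm x)\<^sup>2)" for x :: 'c
    using sum_squares_bound[of 1 "norm x"] norm_ge_zero[of x] by (simp del: norm_ge_zero)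
  then show "AE \<omega> in N. norm (f \<omega>) \<le> norm (1 + (norm (f \<omega>))\<^sup>2)" by simp
qed measurable

text \<open>The penalties of a minimising sequence are Cauchy in L1, so a subsequence of them
  converges almost everywhere. Positions converge directly, cash through the inverse of
  \<open>disutility\<close> provided that its limit is positive, and Fatou's lemma bounds the cost
  of the limit.\<close>

lemma cost_minimizer:
  obtains X where "X \<in> C2" "\<And>Y. Y \<in> C2 \<Longrightarrow> cost X \<le> cost Y"
proof -
  define m where "m = Inf (cost ` C2)"
  have "(\<lambda>\<omega>. 0) \<in> C2"
    using C_zero by (simp add: C2_def)
  then have "C2 \<noteq> {}" by blast
  have bdd: "bdd_below (cost ` C2)"
    by (intro bdd_belowI[of _ 0]) (auto simp: cost_def)
  then have m: "m \<le> cost Y" if "Y \<in> C2" for Y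
    using that unfolding m_def by (intro cInf_lower) auto
  have "\<exists>X\<in>C2. cost X < m + 1 / real (Suc n)" for n
    using cInf_lessD[of "cost ` C2" "m + 1 / real (Suc n)"] \<open>C2 \<noteq> {}\<close> by (auto simp: m_def)
  then obtain X where X: "\<And>n. X n \<in> C2" "\<And>n. cost (X n) < m + 1 / real (Suc n)"
    by metis
  have X_C: "X n \<in> C" and X_int: "integrable N (\<lambda>\<omega>. (norm (penalty (X n \<omega>)))\<^sup>2)" for n
    using X(1) by (auto simp: C2_def)
  note [measurable] = C_measurable[OF X_C]
  have gap_int: "integrable N (\<lambda>\<omega>. (norm (penalty (X i \<omega>) - penalty (X j \<omega>)))\<^sup>2)" for i j
  proof (rule Bochner_Integration.integrable_bound)
    show "integrable N (\<lambda>\<omega>. 2 * (norm (penalty (X i \<omega>)))\<^sup>2 + 2 * (norm (penalty (X j \<omega>)))\<^sup>2)"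
      using X_int by simp
    have "(norm (x - y))\<^sup>2 \<le> 2 * (norm x)\<^sup>2 + 2 * (norm y)\<^sup>2" for x y :: "real \<times> 'b"
      using zero_le_power2[of "norm (x + y)"]
      by (simp add: power2_norm_eq_inner algebra_simps inner_commute)
    then show "AE \<omega> in N. norm ((norm (penalty (X i \<omega>) - penalty (X j \<omega>)))\<^sup>2)
        \<le> norm (2 * (norm (penalty (X i \<omega>)))\<^sup>2 + 2 * (norm (penalty (X j \<omega>)))\<^sup>2)"
      by simp
  qed measurable
  \<comment> \<open>The midpoint costs at least \<open>m\<close>, so \<open>penalty_midpoint\<close>
    bounds the gap by twice the sum of the two excesses of the costs over \<open>m\<close>.\<close>
  have gap: "(LINT \<omega>|N. (norm (penalty (X i \<omega>) - penalty (X j \<omega>)))\<^sup>2)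
      \<le> 2 / real (Suc i) + 2 / real (Suc j)" for i j
  proof -
    let ?mid = "\<lambda>\<omega>. (1/2) *\<^sub>R (X i \<omega> + X j \<omega>)"
    have mid_C: "?mid \<in> C"
      by (intro C_scale C_add X_C) simp
    note [measurable] = C_measurable[OF mid_C]
    let ?B = "\<lambda>\<omega>. ((norm (penalty (X i \<omega>)))\<^sup>2 + (norm (penalty (X j \<omega>)))\<^sup>2) / 2
        - (norm (penalty (X i \<omega>) - penalty (X j \<omega>)))\<^sup>2 / 4"
    have B_int: "integrable N ?B"
      using X_int gap_int by simp
    have mid_int: "integrable N (\<lambda>\<omega>. (norm (penalty (?mid \<omega>)))\<^sup>2)"
      by (rule Bochner_Integration.integrable_bound[OF B_int])
        (auto intro!: order_trans[OF penalty_midpoint] simp del: scaleR_add_right)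
    have mid: "cost ?mid \<le> integral\<^sup>L N ?B"
      unfolding cost_def by (rule integral_mono[OF mid_int B_int penalty_midpoint])
    have "?mid \<in> C2"
      using mid_C mid_int by (simp add: C2_def)
    have "m \<le> (cost (X i) + cost (X j)) / 2
        - (LINT \<omega>|N. (norm (penalty (X i \<omega>) - penalty (X j \<omega>)))\<^sup>2) / 4"
      using m[OF \<open>?mid \<in> C2\<close>] mid X_int gap_int by (simp add: cost_def)
    moreover have "2 * \<delta> = 2 / real (Suc k)" if "\<delta> = 1 / real (Suc k)" for \<delta> k
      using that by simp
    note this[OF refl, of i] this[OF refl, of j]
    ultimately show ?thesis using X(2)[of i] X(2)[of j] by argo
  qed
  have P_int: "integrable N (\<lambda>\<omega>. penalty (X n \<omega>))" for n
    by (rule integrable_of_norm_square[OF _ X_int]) measurable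
  have "\<exists>K. \<forall>i\<ge>K. \<forall>j\<ge>K. (LINT \<omega>|N. norm (penalty (X i \<omega>) - penalty (X j \<omega>))) < e" if e: "0 < e" for e
  proof -
    \<comment> \<open>The parameter of Young's inequality below: the constant term integrates to
      less than \<open>e / 2\<close>, and \<open>K\<close> makes the quadratic term less than
      \<open>e / 2\<close> as well. Adding 1 keeps the denominator positive.\<close>
    define \<delta> where "\<delta> = e / (measure N (space N) + 1)"
    have \<delta>: "0 < \<delta>" "\<delta> * measure N (space N) < e"
      using e add_nonneg_pos[OF measure_nonneg[of N "space N"], of 1] by (auto simp: \<delta>_def field_simps)
    have "0 < e * \<delta> / 4" using e \<delta>(1) by simp
    from reals_Archimedean[OF this]
    obtain K where K: "1 / real (Suc K) < e * \<delta> / 4"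
      by (auto simp: inverse_eq_divide simp del: of_nat_Suc)
    have "(LINT \<omega>|N. norm (penalty (X i \<omega>) - penalty (X j \<omega>))) < e" if "K \<le> i" "K \<le> j" for i j
    proof -
      let ?d = "\<lambda>\<omega>. norm (penalty (X i \<omega>) - penalty (X j \<omega>))"
      have young: "x \<le> \<delta> / 2 + x\<^sup>2 / (2 * \<delta>)" for x
        using \<delta>(1) zero_le_power2[of "x - \<delta>"] by (simp add: field_simps power2_eq_square)
      have "(LINT \<omega>|N. ?d \<omega>) \<le> (LINT \<omega>|N. \<delta> / 2 + (?d \<omega>)\<^sup>2 / (2 * \<delta>))"
        using P_int gap_int young by (intro integral_mono) auto
      also have "\<dots> = \<delta> * measure N (space N) / 2 + (LINT \<omega>|N. (?d \<omega>)\<^sup>2) / (2 * \<delta>)"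
        using gap_int by simp
      also have "\<dots> < e / 2 + e / 2"
      proof (rule add_strict_mono)
        have "(LINT \<omega>|N. (?d \<omega>)\<^sup>2) \<le> 2 / real (Suc i) + 2 / real (Suc j)" by (rule gap)
        also have "\<dots> \<le> 2 / real (Suc K) + 2 / real (Suc K)"
          using that by (intro add_mono divide_left_mono) auto
        also have "\<dots> = 4 * (1 / real (Suc K))" by simp
        also have "\<dots> < e * \<delta>" using K by linarith
        finally show "(LINT \<omega>|N. (?d \<omega>)\<^sup>2) / (2 * \<delta>) < e / 2"
          using \<delta>(1) by (simp add: field_simps)
      qed (use \<delta>(2) in simp)
      finally show ?thesis by simp
    qed
    then show ?thesis by blast
  qed
  from cauchy_L1_AE_cauchy_subseq[OF P_int this]
  obtain r where r: "strict_mono r" "AE \<omega> in N. Cauchy (\<lambda>i. penalty (X (r i) \<omega>))"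
    by blast
  define V where "V \<omega> = lim (\<lambda>i. penalty (X (r i) \<omega>))" for \<omega>
  have V_measurable[measurable]: "V \<in> borel_measurable N"
    unfolding V_def by measurable
  have V: "AE \<omega> in N. (\<lambda>i. penalty (X (r i) \<omega>)) \<longlonglongrightarrow> V \<omega>"
    using r(2) by eventually_elim (simp add: V_def Cauchy_convergent_iff convergent_LIMSEQ_iff)
  define U where "U \<omega> = fst (V \<omega>)" for \<omega>
  define p where "p \<omega> = snd (V \<omega>)" for \<omega>
  have [measurable]: "U \<in> borel_measurable N" "p \<in> borel_measurable N"
    unfolding U_def p_def
    by (auto intro!: measurable_compose[OF V_measurable] borel_measurable_continuous_onI continuous_intros)
  have U: "AE \<omega> in N. (\<lambda>i. disutility (fst (X (r i) \<omega>))) \<longlonglongrightarrow> U \<omega>"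
    using V by eventually_elim (drule tendsto_fst, simp add: penalty_def U_def)
  have p: "AE \<omega> in N. (\<lambda>i. snd (X (r i) \<omega>)) \<longlonglongrightarrow> p \<omega>"
    using V by eventually_elim (drule tendsto_snd, simp add: penalty_def p_def)
  have U_nonneg: "AE \<omega> in N. 0 \<le> U \<omega>"
    using U by eventually_elim (rule LIMSEQ_le_const, auto intro: less_imp_le disutility_pos)
  define x where "x \<omega> = (1 / U \<omega> - U \<omega>) / 2" for \<omega>
  have [measurable]: "x \<in> borel_measurable N"
    unfolding x_def by measurable
  have x_lim: "(\<lambda>i. fst (X (r i) \<omega>)) \<longlonglongrightarrow> x \<omega>"
    if "(\<lambda>i. disutility (fst (X (r i) \<omega>))) \<longlonglongrightarrow> U \<omega>" "U \<omega> \<noteq> 0" for \<omega>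
  proof -
    have "(\<lambda>i. (1 / disutility (fst (X (r i) \<omega>)) - disutility (fst (X (r i) \<omega>))) / 2) \<longlonglongrightarrow> x \<omega>"
      unfolding x_def using that by (intro tendsto_intros) auto
    then show ?thesis by (simp only: disutility_inverse)
  qed
  \<comment> \<open>Cash explodes along the sequence where \<open>U\<close> vanishes, so scaling by \<open>1/k\<close> and capping at 1
    yields free cash there in the limit.\<close>
  define A where "A = {\<omega> \<in> space N. U \<omega> = 0}"
  have A_sets: "A \<in> sets N" unfolding A_def by measurable
  have [measurable]: "Measurable.pred N (\<lambda>\<omega>. U \<omega> = 0)" by measurable
  define Y where "Y k \<omega> = (if U \<omega> = 0 then 1 else min 1 (x \<omega> / real (Suc k)), p \<omega> /\<^sub>R real (Suc k))" for k \<omega>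
  have Y_C: "Y k \<in> C" for k
  proof (rule C_closed)
    let ?Z = "\<lambda>i \<omega>. (min 1 (fst (X (r i) \<omega>) / real (Suc k)), snd (X (r i) \<omega>) /\<^sub>R real (Suc k))"
    have [measurable]: "(\<lambda>\<omega>. fst (X n \<omega>)) \<in> borel_measurable N" "(\<lambda>\<omega>. snd (X n \<omega>)) \<in> borel_measurable N" for n
      by (auto intro!: measurable_compose[OF C_measurable[OF X_C]] borel_measurable_continuous_onI continuous_intros)
    show "?Z i \<in> C" for i
    \<comment> \<open>Free disposal caps the cash at 1, which keeps it convergent even where it
      explodes.\<close>
    proof (rule C_mono)
      show "(\<lambda>\<omega>. inverse (real (Suc k)) *\<^sub>R X (r i) \<omega>) \<in> C"
        by (intro C_scale X_C) simp
    qed (auto simp: divide_inverse mult.commute)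
    show "Y k \<in> borel_measurable N"
      unfolding Y_def by measurable
    show "AE \<omega> in N. (\<lambda>i. ?Z i \<omega>) \<longlonglongrightarrow> Y k \<omega>"
      using U p
    proof eventually_elim
      case (elim \<omega>)
      have "(\<lambda>i. min 1 (fst (X (r i) \<omega>) / real (Suc k))) \<longlonglongrightarrow> (if U \<omega> = 0 then 1 else min 1 (x \<omega> / real (Suc k)))"
      proof (cases "U \<omega> = 0")
        case False
        then show ?thesis
          using x_lim[OF elim(1) False] by (auto intro!: tendsto_intros)
      next
        case True
        let ?K = "real (Suc k)"
        \<comment> \<open>With \<open>u\<close> the disutility of cash,
          \<open>u < 1 / (2 * K + 1)\<close> gives \<open>1 / u > 2 * K + 1\<close> and
          \<open>u < 1\<close>, hence cash \<open>(1 / u - u) / 2 > K\<close>; so the cap at 1 is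
          eventually attained.\<close>
        have "\<forall>\<^sub>F i in sequentially. disutility (fst (X (r i) \<omega>)) < 1 / (2 * ?K + 1)"
          using elim(1) True by (intro order_tendstoD(2)) auto
        then have "\<forall>\<^sub>F i in sequentially. min 1 (fst (X (r i) \<omega>) / ?K) = 1"
        proof eventually_elim
          case (elim i)
          let ?u = "disutility (fst (X (r i) \<omega>))"
          have "2 * ?K + 1 < 1 / ?u"
            using elim disutility_pos[of "fst (X (r i) \<omega>)"] by (simp add: field_simps)
          moreover have "?u < 1"
            using elim by (rule less_le_trans) simp
          ultimately have "?K < fst (X (r i) \<omega>)"
            using disutility_inverse[of "fst (X (r i) \<omega>)"] by argo
          then show ?case by (simp add: field_simps)
        qed
        then show ?thesis using True by (simp add: tendsto_eventually)
      qed
      then show ?case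
        unfolding Y_def by (intro tendsto_Pair tendsto_scaleR tendsto_const elim(2))
    qed
  qed
  have "(\<lambda>\<omega>. (indicator A \<omega>, 0)) \<in> C"
  proof (rule C_closed[where Z=Y, OF Y_C])
    show "AE \<omega> in N. (\<lambda>k. Y k \<omega>) \<longlonglongrightarrow> (indicator A \<omega>, 0)"
    proof (rule AE_I2)
      fix \<omega> assume \<omega>: "\<omega> \<in> space N"
      have "(\<lambda>k. min 1 (x \<omega> / real (Suc k))) \<longlonglongrightarrow> min 1 0"
        by (intro tendsto_min tendsto_const LIMSEQ_Suc lim_const_over_n)
      then have "(\<lambda>k. if U \<omega> = 0 then 1 else min 1 (x \<omega> / real (Suc k))) \<longlonglongrightarrow> indicator A \<omega>"
        using \<omega> by (cases "U \<omega> = 0") (simp_all add: A_def del: of_nat_Suc)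
      moreover have "(\<lambda>k. p \<omega> /\<^sub>R real (Suc k)) \<longlonglongrightarrow> 0 *\<^sub>R p \<omega>"
        by (intro tendsto_scaleR tendsto_const LIMSEQ_inverse_real_of_nat)
      ultimately show "(\<lambda>k. Y k \<omega>) \<longlonglongrightarrow> (indicator A \<omega>, 0)"
        unfolding Y_def by (auto intro: tendsto_Pair)
    qed
  qed (use A_sets in measurable)
  then have "A \<in> null_sets N"
    by (rule C_cash_null[OF A_sets])
  then have "AE \<omega> in N. \<omega> \<notin> A" by (rule AE_not_in)
  with U_nonneg AE_space have U_pos: "AE \<omega> in N. 0 < U \<omega>"
    by eventually_elim (auto simp: A_def less_le)
  define X' where "X' \<omega> = (x \<omega>, p \<omega>)" for \<omega>
  have X'_measurable: "X' \<in> borel_measurable N"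
    unfolding X'_def by measurable
  have X'_C: "X' \<in> C"
  proof (rule C_closed[where Z="\<lambda>i. X (r i)"])
    show "AE \<omega> in N. (\<lambda>i. X (r i) \<omega>) \<longlonglongrightarrow> X' \<omega>"
      using U p U_pos
    proof eventually_elim
      case (elim \<omega>)
      have "(\<lambda>i. (fst (X (r i) \<omega>), snd (X (r i) \<omega>))) \<longlonglongrightarrow> X' \<omega>"
        unfolding X'_def using elim by (intro tendsto_Pair x_lim) auto
      then show ?case by simp
    qed
  qed (simp_all add: X_C X'_measurable)
  note [measurable] = C_measurable[OF X'_C]
  have V_eq: "AE \<omega> in N. penalty (X' \<omega>) = V \<omega>"
    using U_pos by eventually_elim
      (auto simp: penalty_def X'_def x_def disutility_of_inverse U_def p_def)
  \<comment> \<open>Fatou's lemma along the subsequence: the limit has cost at most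
    \<open>m\<close>.\<close>
  have "(\<integral>\<^sup>+\<omega>. ennreal ((norm (penalty (X' \<omega>)))\<^sup>2) \<partial>N)
      = (\<integral>\<^sup>+\<omega>. liminf (\<lambda>i. ennreal ((norm (penalty (X (r i) \<omega>)))\<^sup>2)) \<partial>N)"
  proof (rule nn_integral_cong_AE)
    show "AE \<omega> in N. ennreal ((norm (penalty (X' \<omega>)))\<^sup>2)
        = liminf (\<lambda>i. ennreal ((norm (penalty (X (r i) \<omega>)))\<^sup>2))"
      using V V_eq
    proof eventually_elim
      case (elim \<omega>)
      then have "(\<lambda>i. ennreal ((norm (penalty (X (r i) \<omega>)))\<^sup>2)) \<longlonglongrightarrow> ennreal ((norm (penalty (X' \<omega>)))\<^sup>2)"
        by (intro tendsto_ennrealI tendsto_power tendsto_norm) simp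
      then show ?case
        by (intro lim_imp_Liminf[symmetric] sequentially_bot)
    qed
  qed
  also have "\<dots> \<le> liminf (\<lambda>i. \<integral>\<^sup>+\<omega>. ennreal ((norm (penalty (X (r i) \<omega>)))\<^sup>2) \<partial>N)"
    by (rule nn_integral_liminf) measurable
  also have "\<dots> = liminf (\<lambda>i. ennreal (cost (X (r i))))"
    unfolding cost_def using X_int by (simp add: nn_integral_eq_integral)
  also have "\<dots> = ennreal m"
  proof (rule lim_imp_Liminf)
    have "(\<lambda>n. cost (X n)) \<longlonglongrightarrow> m"
    proof (rule real_tendsto_sandwich[where f="\<lambda>n. m" and h="\<lambda>n. m + 1 / real (Suc n)"])
      have "(\<lambda>n. m + 1 / real (Suc n)) \<longlonglongrightarrow> m + 0"
        by (intro tendsto_add tendsto_const LIMSEQ_Suc lim_const_over_n)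
      then show "(\<lambda>n. m + 1 / real (Suc n)) \<longlonglongrightarrow> m" by simp
    qed (use X m in \<open>auto intro!: eventuallyI less_imp_le\<close>)
    then show "(\<lambda>i. ennreal (cost (X (r i)))) \<longlonglongrightarrow> ennreal m"
      using LIMSEQ_subseq_LIMSEQ[OF _ r(1), of "\<lambda>n. cost (X n)" m] by (simp add: o_def tendsto_ennrealI)
  qed simp
  finally have nn: "(\<integral>\<^sup>+\<omega>. ennreal ((norm (penalty (X' \<omega>)))\<^sup>2) \<partial>N) \<le> ennreal m" .
  have int: "integrable N (\<lambda>\<omega>. (norm (penalty (X' \<omega>)))\<^sup>2)"
    using nn by (intro integrableI_bounded) (auto intro: le_less_trans)
  have "0 \<le> m"
    unfolding m_def using \<open>C2 \<noteq> {}\<close> by (intro cInf_greatest) (auto simp: cost_def)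
  then have "cost X' \<le> m"
    using nn int by (simp add: cost_def nn_integral_eq_integral)
  moreover have "X' \<in> C2"
    using X'_C int by (simp add: C2_def)
  ultimately show ?thesis
    using that m by (meson order_trans)
qed

text \<open>The separating \<open>Z\<close> is the negative gradient of the cost at its minimizer, up to the factor 2.\<close>

lemma separating_density:
  obtains Z where "Z \<in> borel_measurable N" "integrable N (\<lambda>\<omega>. (norm (Z \<omega>))\<^sup>2)"
    "\<And>\<omega>. 0 < fst (Z \<omega>)"
    "\<forall>Y\<in>C. (\<exists>K. \<forall>\<omega>. norm (Y \<omega>) \<le> K) \<longrightarrow> (LINT \<omega>|N. Z \<omega> \<bullet> Y \<omega>) \<le> 0"
proof -
  obtain X where X: "X \<in> C2" and min: "\<And>Y. Y \<in> C2 \<Longrightarrow> cost X \<le> cost Y"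
    by (rule cost_minimizer) (rule that)
  have X_C: "X \<in> C" and X_int: "integrable N (\<lambda>\<omega>. (norm (penalty (X \<omega>)))\<^sup>2)"
    using X by (auto simp: C2_def)
  note X_measurable[measurable] = C_measurable[OF X_C]
  define x where "x \<omega> = fst (X \<omega>)" for \<omega>
  define p where "p \<omega> = snd (X \<omega>)" for \<omega>
  define U where "U \<omega> = disutility (x \<omega>)" for \<omega>
  define s where "s \<omega> = sqrt (1 + (x \<omega>)\<^sup>2)" for \<omega>
  have [measurable]: "x \<in> borel_measurable N" "p \<in> borel_measurable N"
    unfolding x_def p_def
    by (auto intro!: measurable_compose[OF X_measurable] borel_measurable_continuous_onI continuous_intros)
  have [measurable]: "U \<in> borel_measurable N" "s \<in> borel_measurable N"
    unfolding U_def s_def disutility_def by measurable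
  have U: "0 < U \<omega>" "U \<omega> \<le> 2 * s \<omega>" and s: "1 \<le> s \<omega>" for \<omega>
    by (auto simp: U_def s_def disutility_pos disutility_le)
  have Us: "0 \<le> U \<omega> / s \<omega>" "U \<omega> / s \<omega> \<le> 2" for \<omega>
    using U[of \<omega>] s[of \<omega>] by (auto simp: field_simps)
  have norm_X: "(norm (penalty (X \<omega>)))\<^sup>2 = (U \<omega>)\<^sup>2 + (norm (p \<omega>))\<^sup>2" for \<omega>
    by (simp add: norm_penalty U_def x_def p_def)
  \<comment> \<open>The derivative of half the squared disutility is \<open>- U\<^sup>2 / s\<close>,
    since the slope of the disutility is \<open>- U / s\<close>; \<open>Z\<close> is the negative
    gradient of half the squared penalty.\<close>
  define Z where "Z \<omega> = ((U \<omega>)\<^sup>2 / s \<omega>, - p \<omega>)" for \<omega>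
  have Z_measurable[measurable]: "Z \<in> borel_measurable N"
    unfolding Z_def by measurable
  have Z_le: "(norm (Z \<omega>))\<^sup>2 \<le> 4 * (norm (penalty (X \<omega>)))\<^sup>2" for \<omega>
  proof -
    have "(U \<omega> / s \<omega> * U \<omega>)\<^sup>2 \<le> (2 * U \<omega>)\<^sup>2"
      using Us[of \<omega>] U(1)[of \<omega>] s[of \<omega>] by (intro power_mono mult_right_mono) auto
    then have "((U \<omega>)\<^sup>2 / s \<omega>)\<^sup>2 \<le> 4 * (U \<omega>)\<^sup>2"
      by (simp add: power2_eq_square)
    moreover have "(norm (Z \<omega>))\<^sup>2 = ((U \<omega>)\<^sup>2 / s \<omega>)\<^sup>2 + (norm (p \<omega>))\<^sup>2"
      using s[of \<omega>] by (simp add: Z_def norm_Pair)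
    ultimately show ?thesis
      unfolding norm_X using zero_le_power2[of "norm (p \<omega>)"] by argo
  qed
  have Z_int: "integrable N (\<lambda>\<omega>. (norm (Z \<omega>))\<^sup>2)"
    by (rule Bochner_Integration.integrable_bound[where f="\<lambda>\<omega>. 4 * (norm (penalty (X \<omega>)))\<^sup>2"])
      (use X_int Z_le in auto)
  have separates: "(LINT \<omega>|N. Z \<omega> \<bullet> Y \<omega>) \<le> 0" if Y: "Y \<in> C" "\<And>\<omega>. norm (Y \<omega>) \<le> K" for Y K
  proof -
    note Y_measurable[measurable] = C_measurable[OF Y(1)]
    have "0 \<le> K" using Y(2)[of undefined] norm_ge_zero order_trans by blast
    define y where "y \<omega> = fst (Y \<omega>)" for \<omega>
    define q where "q \<omega> = snd (Y \<omega>)" for \<omega>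
    have [measurable]: "y \<in> borel_measurable N" "q \<in> borel_measurable N"
      unfolding y_def q_def
      by (auto intro!: measurable_compose[OF Y_measurable] borel_measurable_continuous_onI continuous_intros)
    have y: "\<bar>y \<omega>\<bar> \<le> K" and q: "norm (q \<omega>) \<le> K" for \<omega>
      using norm_fst_le[of "fst (Y \<omega>)" "snd (Y \<omega>)"] norm_snd_le[of "snd (Y \<omega>)" "fst (Y \<omega>)"] Y(2)[of \<omega>] by (auto simp: y_def q_def)
    have ZY_int: "integrable N (\<lambda>\<omega>. Z \<omega> \<bullet> Y \<omega>)"
    proof (rule Bochner_Integration.integrable_bound)
      show "integrable N (\<lambda>\<omega>. K * norm (Z \<omega>))"
        using integrable_of_norm_square[OF Z_measurable Z_int] by simp
      have "\<bar>Z \<omega> \<bullet> Y \<omega>\<bar> \<le> K * norm (Z \<omega>)" for \<omega>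
        using Cauchy_Schwarz_ineq2[of "Z \<omega>" "Y \<omega>"] mult_left_mono[OF Y(2)[of \<omega>] norm_ge_zero[of "Z \<omega>"]]
        by (simp add: mult.commute)
      then show "AE \<omega> in N. norm (Z \<omega> \<bullet> Y \<omega>) \<le> norm (K * norm (Z \<omega>))"
        using \<open>0 \<le> K\<close> by simp
    qed measurable
    \<comment> \<open>Collects the constants of the second-order remainder:
      \<open>4 * K\<^sup>2\<close> from the squared slope term, \<open>2 * K\<^sup>2\<close> from
      the securities, and the cubic and quartic terms from the square of the cash expansion.\<close>
    define D where "D = 6 * K\<^sup>2 + 2 * K ^ 3 + K ^ 4"
    have U_int: "integrable N U"
    proof (rule integrable_of_norm_square)
      show "integrable N (\<lambda>\<omega>. (norm (U \<omega>))\<^sup>2)"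
        by (rule Bochner_Integration.integrable_bound[OF X_int]) (auto simp: norm_X)
    qed measurable
    \<comment> \<open>The remainder is affine in \<open>U\<close>, which is integrable because its
      square is and the measure is finite; thus the first-order term dominates as
      \<open>\<epsilon>\<close> tends to 0.\<close>
    have bound: "(norm (penalty (X \<omega> + \<epsilon> *\<^sub>R Y \<omega>)))\<^sup>2
        \<le> (norm (penalty (X \<omega>)))\<^sup>2 - 2 * \<epsilon> * (Z \<omega> \<bullet> Y \<omega>) + \<epsilon>\<^sup>2 * (K\<^sup>2 * U \<omega> + D)"
      if \<epsilon>: "0 < \<epsilon>" "\<epsilon> \<le> 1" for \<epsilon> \<omega>
    proof -
      define a where "a = - (y \<omega> * (U \<omega> / s \<omega>))"
      define b where "b = (y \<omega>)\<^sup>2 / 2"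
      have a: "\<bar>a\<bar> \<le> K * 2"
        unfolding a_def abs_minus_cancel abs_mult abs_of_nonneg[OF Us(1)]
        using y Us \<open>0 \<le> K\<close> by (intro mult_mono) auto
      have b: "0 \<le> b" "b \<le> K\<^sup>2 / 2"
        using power_mono[OF y[of \<omega>], of 2] by (auto simp: b_def)
      have "disutility (x \<omega> + \<epsilon> * y \<omega>) \<le> U \<omega> + \<epsilon> * a + \<epsilon>\<^sup>2 * b"
        using disutility_add_le[of "x \<omega>" "\<epsilon> * y \<omega>"]
        by (simp add: U_def s_def a_def b_def power_mult_distrib mult.assoc)
      then have "(disutility (x \<omega> + \<epsilon> * y \<omega>))\<^sup>2 \<le> (U \<omega> + \<epsilon> * a + \<epsilon>\<^sup>2 * b)\<^sup>2"
        using disutility_pos by (intro power_mono) (auto simp: less_imp_le)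
      also have "\<dots> = (U \<omega>)\<^sup>2 + 2 * \<epsilon> * (U \<omega> * a)
          + \<epsilon>\<^sup>2 * (a\<^sup>2 + 2 * (U \<omega> * b) + \<epsilon> * (2 * (a * b)) + \<epsilon>\<^sup>2 * b\<^sup>2)"
        by (simp add: algebra_simps power2_eq_square)
      also have "\<dots> \<le> (U \<omega>)\<^sup>2 + 2 * \<epsilon> * (U \<omega> * a)
          + \<epsilon>\<^sup>2 * (4 * K\<^sup>2 + K\<^sup>2 * U \<omega> + 2 * K ^ 3 + K ^ 4)"
      proof (intro add_left_mono mult_left_mono)
        have "a\<^sup>2 \<le> (K * 2)\<^sup>2"
          using power_mono[OF a, of 2] by simp
        moreover have "U \<omega> * b \<le> U \<omega> * (K\<^sup>2 / 2)"
          using U(1)[of \<omega>] b by (intro mult_left_mono) auto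
        moreover have "\<epsilon> * (2 * (a * b)) \<le> 1 * (2 * (K * 2 * (K\<^sup>2 / 2)))"
        proof -
          have "a * b \<le> K * 2 * (K\<^sup>2 / 2)"
            using a b \<open>0 \<le> K\<close> by (intro mult_mono) auto
          then have "\<epsilon> * (2 * (a * b)) \<le> \<epsilon> * (2 * (K * 2 * (K\<^sup>2 / 2)))"
            using \<epsilon> by (intro mult_left_mono) auto
          also have "\<dots> \<le> 1 * (2 * (K * 2 * (K\<^sup>2 / 2)))"
            using \<epsilon> \<open>0 \<le> K\<close> by (intro mult_right_mono) auto
          finally show ?thesis .
        qed
        moreover have "\<epsilon>\<^sup>2 * b\<^sup>2 \<le> 1 * (K\<^sup>2 / 2)\<^sup>2"
          using \<epsilon> b by (intro mult_mono power_mono) (auto simp: power_le_one)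
        moreover have "(K\<^sup>2 / 2)\<^sup>2 \<le> K ^ 4" "(K * 2)\<^sup>2 = 4 * K\<^sup>2" "2 * (K * 2 * (K\<^sup>2 / 2)) = 2 * K ^ 3"
          "2 * (U \<omega> * (K\<^sup>2 / 2)) = K\<^sup>2 * U \<omega>"
          using \<open>0 \<le> K\<close> by (auto simp: power_divide power_mult_distrib eval_nat_numeral)
        ultimately show "a\<^sup>2 + 2 * (U \<omega> * b) + \<epsilon> * (2 * (a * b)) + \<epsilon>\<^sup>2 * b\<^sup>2
            \<le> 4 * K\<^sup>2 + K\<^sup>2 * U \<omega> + 2 * K ^ 3 + K ^ 4"
          by linarith
      qed simp
      finally have 1: "(disutility (x \<omega> + \<epsilon> * y \<omega>))\<^sup>2 \<le> \<dots>" .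
      have "(norm (p \<omega> + \<epsilon> *\<^sub>R q \<omega>))\<^sup>2 = (norm (p \<omega>))\<^sup>2 + 2 * \<epsilon> * (p \<omega> \<bullet> q \<omega>) + \<epsilon>\<^sup>2 * (norm (q \<omega>))\<^sup>2"
        by (simp add: power2_norm_eq_inner inner_add inner_commute power2_eq_square[of \<epsilon>] algebra_simps)
      moreover have "\<epsilon>\<^sup>2 * (norm (q \<omega>))\<^sup>2 \<le> \<epsilon>\<^sup>2 * (2 * K\<^sup>2)"
        using order_trans[OF power_mono[OF q[of \<omega>] norm_ge_zero, of 2], of "2 * K\<^sup>2"]
        by (intro mult_left_mono) auto
      ultimately have 2: "(norm (p \<omega> + \<epsilon> *\<^sub>R q \<omega>))\<^sup>2
          \<le> (norm (p \<omega>))\<^sup>2 + 2 * \<epsilon> * (p \<omega> \<bullet> q \<omega>) + \<epsilon>\<^sup>2 * (2 * K\<^sup>2)"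
        by simp
      have ZY: "Z \<omega> \<bullet> Y \<omega> = - (U \<omega> * a) - p \<omega> \<bullet> q \<omega>"
        by (simp add: Z_def inner_prod_def y_def q_def a_def power2_eq_square)
      show ?thesis
        using 1 2 unfolding norm_X ZY
        by (simp add: norm_penalty D_def algebra_simps flip: x_def y_def p_def q_def)
    qed
    define R where "R = (LINT \<omega>|N. K\<^sup>2 * U \<omega> + D)"
    have R_int: "integrable N (\<lambda>\<omega>. K\<^sup>2 * U \<omega> + D)"
      using U_int by simp
    \<comment> \<open>Minimality against the perturbation by
      \<open>\<epsilon> *\<^sub>R Y \<omega>\<close>, which stays in the cone, divided by
      \<open>\<epsilon>\<close>.\<close>
    have step: "(LINT \<omega>|N. Z \<omega> \<bullet> Y \<omega>) \<le> \<epsilon> * R" if \<epsilon>: "0 < \<epsilon>" "\<epsilon> \<le> 1" for \<epsilon>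
    proof -
      let ?Y = "\<lambda>\<omega>. X \<omega> + \<epsilon> *\<^sub>R Y \<omega>"
      let ?B = "\<lambda>\<omega>. (norm (penalty (X \<omega>)))\<^sup>2 - 2 * \<epsilon> * (Z \<omega> \<bullet> Y \<omega>) + \<epsilon>\<^sup>2 * (K\<^sup>2 * U \<omega> + D)"
      have B_int: "integrable N ?B"
        using X_int ZY_int R_int by simp
      have Y_C: "?Y \<in> C"
        using \<epsilon> by (intro C_add C_scale X_C Y(1)) auto
      note [measurable] = C_measurable[OF Y_C]
      have Y_int: "integrable N (\<lambda>\<omega>. (norm (penalty (?Y \<omega>)))\<^sup>2)"
        by (rule Bochner_Integration.integrable_bound[OF B_int])
          (auto intro!: order_trans[OF bound[OF \<epsilon>]])
      then have "cost X \<le> cost ?Y"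
        using Y_C by (intro min) (simp add: C2_def)
      also have "\<dots> \<le> integral\<^sup>L N ?B"
        unfolding cost_def by (rule integral_mono[OF Y_int B_int bound[OF \<epsilon>]])
      also have "\<dots> = cost X - 2 * \<epsilon> * (LINT \<omega>|N. Z \<omega> \<bullet> Y \<omega>) + \<epsilon>\<^sup>2 * R"
        using X_int ZY_int R_int by (simp add: cost_def R_def)
      finally have "\<epsilon> * (2 * (LINT \<omega>|N. Z \<omega> \<bullet> Y \<omega>)) \<le> \<epsilon> * (\<epsilon> * R)"
        by (simp add: power2_eq_square algebra_simps)
      then have "2 * (LINT \<omega>|N. Z \<omega> \<bullet> Y \<omega>) \<le> \<epsilon> * R"
        using \<epsilon>(1) by simp
      moreover have "0 \<le> R"
        unfolding R_def D_def using U(1) \<open>0 \<le> K\<close>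
        by (intro Bochner_Integration.integral_nonneg) (auto intro!: add_nonneg_nonneg mult_nonneg_nonneg simp: less_imp_le)
      ultimately show ?thesis
        using \<epsilon>(1) by (smt (verit) mult_nonneg_nonneg)
    qed
    have "((\<lambda>\<epsilon>. \<epsilon> * R) \<longlongrightarrow> 0 * R) (at_right 0)"
      by (intro tendsto_intros)
    then show ?thesis
      using step
      by (intro tendsto_lowerbound[where f="\<lambda>\<epsilon>. \<epsilon> * R" and F="at_right (0::real)"])
        (auto simp: eventually_at_right_field intro!: exI[of _ 1])
  qed
  have "0 < fst (Z \<omega>)" for \<omega>
    using U(1)[of \<omega>] s[of \<omega>] by (simp add: Z_def)
  moreover have "\<forall>Y\<in>C. (\<exists>K. \<forall>\<omega>. norm (Y \<omega>) \<le> K) \<longrightarrow> (LINT \<omega>|N. Z \<omega> \<bullet> Y \<omega>) \<le> 0"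
    using separates by blast
  ultimately show ?thesis
    by (rule that[OF Z_measurable Z_int])
qed

end

section \<open>Martingales and conditional expectations\<close>

lemma signed_value_same: "signed_value x p p = x \<bullet> p"
  by (simp add: signed_value_def inner_vec_def)

lemma signed_value_scale: "0 \<le> c \<Longrightarrow> signed_value (c *\<^sub>R x) p q = c * signed_value x p q"
  unfolding signed_value_def sum_distrib_left
  by (intro sum.cong) (auto simp: zero_le_mult_iff)

lemma signed_value_scale_prices: "signed_value x (c *\<^sub>R p) (c *\<^sub>R q) = c * signed_value x p q"
  unfolding signed_value_def sum_distrib_left by (intro sum.cong) auto

lemma signed_value_add_prices: "signed_value x (p + d) (q + d) = signed_value x p q + x \<bullet> d"
  unfolding signed_value_def inner_vec_def sum.distrib[symmetric]
  by (intro sum.cong) (auto simp: algebra_simps)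

lemma signed_value_minus: "signed_value (- x) p q = - signed_value x q p"
  unfolding signed_value_def sum_negf[symmetric] by (intro sum.cong) auto

text \<open>When buying is no cheaper than selling, each coordinate is a maximum of two linear
  functions of the position; subadditivity follows.\<close>

lemma signed_value_max:
  assumes "q \<le> p"
  shows "signed_value x p q = (\<Sum>j\<in>UNIV. max (x $ j * p $ j) (x $ j * q $ j))"
proof -
  have "y * (if 0 \<le> y then a else b) = max (y * a) (y * b)" if "b \<le> a" for y a b :: real
    using that mult_left_mono[of b a y] mult_left_mono_neg[of b a y] by (simp add: max_absorb1 max_absorb2)
  then show ?thesis
    unfolding signed_value_def using assms by (simp add: less_eq_vec_def)
qed

lemma signed_value_add_le:
  assumes "q \<le> p"
  shows "signed_value (x + y) p q \<le> signed_value x p q + signed_value y p q"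
  unfolding signed_value_max[OF assms] sum.distrib[symmetric]
  by (intro sum_mono) (auto simp: algebra_simps max_def)

lemma inner_le_signed_value:
  assumes "q \<le> s" "s \<le> p"
  shows "x \<bullet> s \<le> signed_value x p q"
  unfolding signed_value_def inner_vec_def
  using assms by (intro sum_mono) (auto simp: less_eq_vec_def mult_left_mono mult_left_mono_neg)

lemma signed_value_continuous: "continuous_on UNIV (\<lambda>x. signed_value x p q)"
proof -
  have "x * (if 0 \<le> x then a else b) = max x 0 * a + min x 0 * b" for x a b :: real
    by auto
  then show ?thesis
    unfolding signed_value_def by (auto intro!: continuous_intros)
qed

lemma borel_measurable_vec_nth[measurable (raw)]:
  fixes f :: "'a \<Rightarrow> real ^ 'n"
  shows "f \<in> borel_measurable M \<Longrightarrow> (\<lambda>\<omega>. f \<omega> $ j) \<in> borel_measurable M"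
  by (rule borel_measurable_continuous_on[where f="\<lambda>x. x $ j"]) (auto intro: continuous_intros)

lemma signed_value_measurable[measurable (raw)]:
  fixes f p q :: "'a \<Rightarrow> real ^ 'n"
  assumes [measurable]: "f \<in> borel_measurable M" "p \<in> borel_measurable M" "q \<in> borel_measurable M"
  shows "(\<lambda>\<omega>. signed_value (f \<omega>) (p \<omega>) (q \<omega>)) \<in> borel_measurable M"
  unfolding signed_value_def by measurable

lemma borel_measurable_fst_comp[measurable (raw)]:
  fixes f :: "'a \<Rightarrow> 'b::topological_space \<times> 'c::topological_space"
  shows "f \<in> borel_measurable M \<Longrightarrow> (\<lambda>\<omega>. fst (f \<omega>)) \<in> borel_measurable M"
  by (erule measurable_compose) (intro borel_measurable_continuous_onI continuous_intros)

lemma borel_measurable_snd_comp[measurable (raw)]: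
  fixes f :: "'a \<Rightarrow> 'b::topological_space \<times> 'c::topological_space"
  shows "f \<in> borel_measurable M \<Longrightarrow> (\<lambda>\<omega>. snd (f \<omega>)) \<in> borel_measurable M"
  by (erule measurable_compose) (intro borel_measurable_continuous_onI continuous_intros)

text \<open>Summation by parts: final holdings minus the cost of building them up is a transform of
  the price process.\<close>

lemma sum_by_parts_inner:
  fixes \<theta> X :: "nat \<Rightarrow> 'b::real_inner"
  assumes "\<theta> 0 = 0"
  shows "\<theta> n \<bullet> X n - (\<Sum>t<n. (\<theta> (Suc t) - \<theta> t) \<bullet> X t) = (\<Sum>t<n. \<theta> (Suc t) \<bullet> (X (Suc t) - X t))"
  by (induction n) (auto simp: assms inner_diff algebra_simps)

lemma AE_of_forall_norm_le:
  fixes f :: "'a \<Rightarrow> 'b::real_normed_vector"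
  assumes "\<And>m::nat. AE \<omega> in M. norm (f \<omega>) \<le> m \<longrightarrow> P \<omega>"
  shows "AE \<omega> in M. P \<omega>"
proof -
  have "AE \<omega> in M. \<forall>m::nat. norm (f \<omega>) \<le> m \<longrightarrow> P \<omega>"
    unfolding AE_all_countable using assms by blast
  then show ?thesis
    by eventually_elim (use real_arch_simple in blast)
qed

text \<open>Test on the set where the conditional expectation exceeds \<open>g\<close>. Cutting it
  to bounded \<open>g\<close> makes the integrals finite and leaves only test sets that correspond
  to bounded portfolios.\<close>

lemma (in finite_measure_subalgebra) real_cond_exp_le_of_set_integral_le:
  assumes f: "integrable M f" and g[measurable]: "g \<in> borel_measurable F"
    and le: "\<And>B K. B \<in> sets F \<Longrightarrow> (\<And>\<omega>. \<omega> \<in> B \<Longrightarrow> \<bar>g \<omega>\<bar> \<le> K) \<Longrightarrow>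
      (LINT \<omega>|M. indicator B \<omega> * (f \<omega> - g \<omega>)) \<le> 0"
  shows "AE \<omega> in M. real_cond_exp M F f \<omega> \<le> g \<omega>"
proof (rule AE_of_forall_norm_le)
  fix m :: nat
  have [measurable]: "g \<in> borel_measurable M"
    by (rule measurable_from_subalg[OF subalg g])
  let ?E = "real_cond_exp M F f"
  define B where "B = {\<omega> \<in> space F. g \<omega> < ?E \<omega> \<and> \<bar>g \<omega>\<bar> \<le> m}"
  have B[measurable]: "B \<in> sets F"
    unfolding B_def by measurable
  have B_M[measurable]: "B \<in> sets M"
    using B subalg by (auto simp: subalgebra_def)
  have space: "space F = space M"
    using subalg by (simp add: subalgebra_def)
  have [measurable]: "f \<in> borel_measurable M"
    using f by measurable
  have int_f: "integrable M (\<lambda>\<omega>. indicator B \<omega> * f \<omega>)"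
    using integrable_mult_indicator[OF B_M f] by simp
  have int_E: "integrable M (\<lambda>\<omega>. indicator B \<omega> * ?E \<omega>)"
    using integrable_mult_indicator[OF B_M real_cond_exp_int(1)[OF f]] by simp
  have int_g: "integrable M (\<lambda>\<omega>. indicator B \<omega> * g \<omega>)"
  proof (rule integrable_const_bound[where B="real m"])
    show "AE \<omega> in M. norm (indicator B \<omega> * g \<omega>) \<le> real m"
      by (auto simp: B_def indicator_def)
  qed measurable
  have "(LINT \<omega>|M. indicator B \<omega> * (?E \<omega> - g \<omega>)) = (LINT \<omega>|M. indicator B \<omega> * (f \<omega> - g \<omega>))"
    using int_f int_E int_g real_cond_exp_intg(2)[OF int_f] by (simp add: right_diff_distrib)
  also have "\<dots> \<le> 0"
    by (rule le[OF B, of m]) (simp add: B_def)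
  finally have "(LINT \<omega>|M. indicator B \<omega> * (?E \<omega> - g \<omega>)) \<le> 0" .
  moreover have nonneg: "0 \<le> indicator B \<omega> * (?E \<omega> - g \<omega>)" for \<omega>
    by (auto simp: B_def indicator_def)
  ultimately have "(LINT \<omega>|M. indicator B \<omega> * (?E \<omega> - g \<omega>)) = 0"
    by (intro antisym Bochner_Integration.integral_nonneg) auto
  then have "AE \<omega> in M. indicator B \<omega> * (?E \<omega> - g \<omega>) = 0"
    using int_E int_g nonneg
    by (subst (asm) integral_nonneg_eq_0_iff_AE) (auto simp: right_diff_distrib)
  with AE_space show "AE \<omega> in M. norm (g \<omega>) \<le> m \<longrightarrow> ?E \<omega> \<le> g \<omega>"
    by eventually_elim (auto simp: B_def space indicator_def split: if_splits)
qed

section \<open>Martingale transforms in discrete time\<close>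

locale filtered_prob_space = prob_space Q for Q :: "'a measure" +
  fixes F :: "nat \<Rightarrow> 'a measure" and T :: nat
  assumes subalgebra_F: "t \<le> T \<Longrightarrow> subalgebra Q (F t)"
    and F_mono: "s \<le> t \<Longrightarrow> sets (F s) \<subseteq> sets (F t)"
begin

lemma measurable_from_F: "t \<le> T \<Longrightarrow> f \<in> borel_measurable (F t) \<Longrightarrow> f \<in> borel_measurable Q"
  using measurable_from_subalg[OF subalgebra_F] by blast

lemma measurable_F_mono:
  "s \<le> t \<Longrightarrow> t \<le> T \<Longrightarrow> f \<in> borel_measurable (F s) \<Longrightarrow> f \<in> borel_measurable (F t)"
  using subalgebra_F[of s] subalgebra_F[of t] F_mono[of s t]
  by (auto intro!: measurable_from_subalg[of "F t" "F s"] simp: subalgebra_def)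

lemma finite_subalgebra: "t \<le> T \<Longrightarrow> finite_measure_subalgebra Q (F t)"
  using subalgebra_F by unfold_locales

lemma martingale_increment_bounded:
  fixes X :: "nat \<Rightarrow> 'a \<Rightarrow> real ^ 'n"
  assumes X: "martingale_upto Q F T X" and t: "Suc t \<le> T"
    and g[measurable]: "g \<in> borel_measurable (F t)" and bounded: "\<And>\<omega>. norm (g \<omega>) \<le> K"
  shows "integrable Q (\<lambda>\<omega>. g \<omega> \<bullet> (X (Suc t) \<omega> - X t \<omega>))"
    and "(LINT \<omega>|Q. g \<omega> \<bullet> (X (Suc t) \<omega> - X t \<omega>)) = 0"
proof -
  interpret S: finite_measure_subalgebra Q "F t"
    using t by (intro finite_subalgebra) simp
  have g_Q[measurable]: "g \<in> borel_measurable Q"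
    using measurable_from_F[OF _ g] t by simp
  have int: "integrable Q (X u)" if "u \<le> T" for u
    using X that by (simp add: martingale_upto_def)
  have X_int: "integrable Q (\<lambda>\<omega>. X u \<omega> $ j)" if "u \<le> T" for u j
    using integrable_inner_left[OF int[OF that], of "axis j 1"] by (simp add: inner_axis)
  have gX_int: "integrable Q (\<lambda>\<omega>. g \<omega> $ j * X u \<omega> $ j)" if "u \<le> T" for u j
  proof (rule Bochner_Integration.integrable_bound)
    show "integrable Q (\<lambda>\<omega>. K * X u \<omega> $ j)" using X_int[OF that] by simp
    have "\<bar>g \<omega> $ j\<bar> \<le> \<bar>K\<bar>" for \<omega>
      using component_le_norm_cart[of "g \<omega>" j] bounded[of \<omega>] by simp
    then show "AE \<omega> in Q. norm (g \<omega> $ j * X u \<omega> $ j) \<le> norm (K * X u \<omega> $ j)"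
      by (auto simp: abs_mult intro!: mult_right_mono)
    show "(\<lambda>\<omega>. g \<omega> $ j * X u \<omega> $ j) \<in> borel_measurable Q"
      using int[OF that] by measurable
  qed
  have eq: "(LINT \<omega>|Q. g \<omega> $ j * X (Suc t) \<omega> $ j) = (LINT \<omega>|Q. g \<omega> $ j * X t \<omega> $ j)" for j
  proof -
    have "(LINT \<omega>|Q. g \<omega> $ j * X (Suc t) \<omega> $ j)
        = (LINT \<omega>|Q. g \<omega> $ j * real_cond_exp Q (F t) (\<lambda>\<omega>. X (Suc t) \<omega> $ j) \<omega>)"
      by (rule S.real_cond_exp_intg(2)[symmetric, OF gX_int[OF t]])
        (rule borel_measurable_vec_nth[OF g], rule borel_measurable_integrable[OF X_int[OF t]])
    also have "\<dots> = (LINT \<omega>|Q. g \<omega> $ j * X t \<omega> $ j)"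
    proof (rule integral_cong_AE)
      have "AE \<omega> in Q. real_cond_exp Q (F t) (\<lambda>\<omega>. X (Suc t) \<omega> $ j) \<omega> = X t \<omega> $ j"
        using X t unfolding martingale_upto_def by simp
      then show "AE \<omega> in Q. g \<omega> $ j * real_cond_exp Q (F t) (\<lambda>\<omega>. X (Suc t) \<omega> $ j) \<omega> = g \<omega> $ j * X t \<omega> $ j"
        by eventually_elim simp
      show "(\<lambda>\<omega>. g \<omega> $ j * X t \<omega> $ j) \<in> borel_measurable Q"
        using borel_measurable_integrable[OF gX_int[of t j]] t by simp
    qed (intro borel_measurable_times borel_measurable_vec_nth g_Q borel_measurable_cond_exp2)
    finally show ?thesis .
  qed
  have inner: "g \<omega> \<bullet> (X (Suc t) \<omega> - X t \<omega>)
      = (\<Sum>j\<in>UNIV. g \<omega> $ j * X (Suc t) \<omega> $ j - g \<omega> $ j * X t \<omega> $ j)" for \<omega>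
    by (simp add: inner_vec_def right_diff_distrib)
  show "integrable Q (\<lambda>\<omega>. g \<omega> \<bullet> (X (Suc t) \<omega> - X t \<omega>))"
    unfolding inner using t by (intro Bochner_Integration.integrable_sum Bochner_Integration.integrable_diff gX_int) auto
  show "(LINT \<omega>|Q. g \<omega> \<bullet> (X (Suc t) \<omega> - X t \<omega>)) = 0"
    unfolding inner using t by (simp add: gX_int eq)
qed

text \<open>Truncating \<open>\<theta>\<close> to a bounded multiplier supported in \<open>B\<close>
  gives a nonnegative integrand with integral zero; the truncations exhaust
  \<open>B\<close>.\<close>

lemma martingale_increment_AE_0:
  fixes X :: "nat \<Rightarrow> 'a \<Rightarrow> real ^ 'n"
  assumes X: "martingale_upto Q F T X" and t: "Suc t \<le> T"
    and \<theta>[measurable]: "\<theta> \<in> borel_measurable (F t)" and B[measurable]: "B \<in> sets (F t)"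
    and nonneg: "AE \<omega> in Q. \<omega> \<in> B \<longrightarrow> 0 \<le> \<theta> \<omega> \<bullet> (X (Suc t) \<omega> - X t \<omega>)"
  shows "AE \<omega> in Q. \<omega> \<in> B \<longrightarrow> \<theta> \<omega> \<bullet> (X (Suc t) \<omega> - X t \<omega>) = 0"
proof (rule AE_of_forall_norm_le[of \<theta>])
  fix m :: nat
  define g where "g \<omega> = (if \<omega> \<in> B \<and> norm (\<theta> \<omega>) \<le> m then \<theta> \<omega> else 0)" for \<omega>
  have [measurable]: "g \<in> borel_measurable (F t)"
    unfolding g_def by measurable
  have "norm (g \<omega>) \<le> m" for \<omega>
    by (simp add: g_def)
  note mart = martingale_increment_bounded[OF X t _ this, simplified]
  have "AE \<omega> in Q. 0 \<le> g \<omega> \<bullet> (X (Suc t) \<omega> - X t \<omega>)"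
    using nonneg by eventually_elim (simp add: g_def)
  then have "AE \<omega> in Q. g \<omega> \<bullet> (X (Suc t) \<omega> - X t \<omega>) = 0"
    using integral_nonneg_eq_0_iff_AE[OF mart(1)] mart(2) by simp
  then show "AE \<omega> in Q. norm (\<theta> \<omega>) \<le> m \<longrightarrow> \<omega> \<in> B \<longrightarrow> \<theta> \<omega> \<bullet> (X (Suc t) \<omega> - X t \<omega>) = 0"
    by eventually_elim (auto simp: g_def)
qed

text \<open>Induction on the last increment, which handles unbounded \<open>\<theta>\<close>. Where
  the earlier gains \<open>G\<close> are negative, the last increment must be nonnegative, hence
  zero by the previous lemma; so \<open>G\<close> is nonnegative and vanishes by induction. A second
  application kills the last increment.\<close>

lemma nonneg_martingale_transform_AE_0:
  fixes X \<theta> :: "nat \<Rightarrow> 'a \<Rightarrow> real ^ 'n"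
  assumes X: "martingale_upto Q F T X"
    and \<theta>: "\<And>t. Suc t \<le> T \<Longrightarrow> \<theta> (Suc t) \<in> borel_measurable (F t)"
    and "n \<le> T"
    and "AE \<omega> in Q. 0 \<le> (\<Sum>t<n. \<theta> (Suc t) \<omega> \<bullet> (X (Suc t) \<omega> - X t \<omega>))"
  shows "AE \<omega> in Q. (\<Sum>t<n. \<theta> (Suc t) \<omega> \<bullet> (X (Suc t) \<omega> - X t \<omega>)) = 0"
  using assms(3,4)
proof (induction n)
  case (Suc n)
  define G where "G \<omega> = (\<Sum>t<n. \<theta> (Suc t) \<omega> \<bullet> (X (Suc t) \<omega> - X t \<omega>))" for \<omega>
  define Y where "Y \<omega> = \<theta> (Suc n) \<omega> \<bullet> (X (Suc n) \<omega> - X n \<omega>)" for \<omega>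
  have GY: "AE \<omega> in Q. 0 \<le> G \<omega> + Y \<omega>"
    using Suc.prems(2) by (simp add: G_def Y_def)
  note [measurable] = \<theta>[OF Suc.prems(1)]
  have space: "space (F n) = space Q"
    using subalgebra_F[of n] Suc.prems(1) by (simp add: subalgebra_def)
  have [measurable]: "G \<in> borel_measurable (F n)"
    unfolding G_def
  proof (intro borel_measurable_sum borel_measurable_inner borel_measurable_diff)
    fix t assume "t \<in> {..<n}"
    then have "t \<le> n" "Suc t \<le> n" by auto
    then show "\<theta> (Suc t) \<in> borel_measurable (F n)"
        "X (Suc t) \<in> borel_measurable (F n)" "X t \<in> borel_measurable (F n)"
      using \<theta>[of t] X Suc.prems(1)
      by (auto simp: martingale_upto_def intro: measurable_F_mono[of t n] measurable_F_mono[of "Suc t" n])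
  qed
  define B where "B = {\<omega> \<in> space (F n). G \<omega> < 0}"
  have B: "B \<in> sets (F n)" unfolding B_def by measurable
  have "AE \<omega> in Q. \<omega> \<in> B \<longrightarrow> 0 \<le> Y \<omega>"
    using GY by eventually_elim (auto simp: B_def)
  then have "AE \<omega> in Q. \<omega> \<in> B \<longrightarrow> Y \<omega> = 0"
    unfolding Y_def by (intro martingale_increment_AE_0[OF X Suc.prems(1)] B) auto
  with GY AE_space have "AE \<omega> in Q. 0 \<le> G \<omega>"
    by eventually_elim (auto simp: B_def space not_less)
  then have G: "AE \<omega> in Q. G \<omega> = 0"
    using Suc.IH Suc.prems(1) by (simp add: G_def)
  with GY have "AE \<omega> in Q. \<omega> \<in> space (F n) \<longrightarrow> 0 \<le> Y \<omega>"
    by eventually_elim simp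
  then have "AE \<omega> in Q. \<omega> \<in> space (F n) \<longrightarrow> Y \<omega> = 0"
    unfolding Y_def by (intro martingale_increment_AE_0[OF X Suc.prems(1)]) auto
  with G AE_space show ?case
    by eventually_elim (simp add: G_def Y_def space)
qed simp

end

section \<open>Self-financing strategies in discounted terms\<close>

text \<open>The normalisation of the savings account at time 0 makes the initial purchase, which is
  paid at undiscounted prices, agree with its discounted cost.\<close>

locale common_dividend_market = dividend_market M F T r Pask Pbid Aask Abid
  for M :: "'a measure" and F :: "nat \<Rightarrow> 'a measure" and T :: nat
    and r :: "nat \<Rightarrow> 'a \<Rightarrow> real"
    and Pask Pbid Aask Abid :: "nat \<Rightarrow> 'a \<Rightarrow> real ^ 'n" +
  assumes savings_0: "AE \<omega> in M. savings 0 \<omega> = 1"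
    and same_dividends: "1 \<le> t \<Longrightarrow> t \<le> T \<Longrightarrow> AE \<omega> in M. Aask t \<omega> = Abid t \<omega>"
begin

definition gain :: "nat \<Rightarrow> 'a \<Rightarrow> real ^ 'n" where
  "gain t \<omega> = (\<Sum>u=1..t. discounted (increment Aask) u \<omega>)"

text \<open>Cum-dividend discounted prices: dividends are reinvested in the savings account.\<close>

definition ask :: "nat \<Rightarrow> 'a \<Rightarrow> real ^ 'n" where
  "ask t \<omega> = discounted Pask t \<omega> + gain t \<omega>"

definition bid :: "nat \<Rightarrow> 'a \<Rightarrow> real ^ 'n" where
  "bid t \<omega> = discounted Pbid t \<omega> + gain t \<omega>"

text \<open>Collects the almost sure assumptions for one \<omega>, so that the accounting can be
  done path by path.\<close>

definition regular :: "'a \<Rightarrow> bool" where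
  "regular \<omega> \<longleftrightarrow> savings 0 \<omega> = 1 \<and>
     (\<forall>t\<in>{..T}. 1 \<le> savings t \<omega> \<and> Aask t \<omega> = Abid t \<omega> \<and> Pbid t \<omega> \<le> Pask t \<omega>)"

lemma AE_regular: "AE \<omega> in M. regular \<omega>"
proof -
  have "AE \<omega> in M. \<forall>t\<in>{..T}. 0 \<le> r t \<omega>" "AE \<omega> in M. \<forall>t\<in>{..T}. Pbid t \<omega> \<le> Pask t \<omega>"
    using rate_nonneg bid_le_ask by (auto intro!: AE_finite_allI)
  moreover have "AE \<omega> in M. \<forall>t\<in>{..T}. Aask t \<omega> = Abid t \<omega>"
  proof (intro AE_finite_allI)
    show "AE \<omega> in M. Aask t \<omega> = Abid t \<omega>" if "t \<in> {..T}" for t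
      using same_dividends[of t] that by (cases t) (auto simp: Aask_0 Abid_0)
  qed simp
  ultimately show ?thesis
    using savings_0
  proof eventually_elim
    case (elim \<omega>)
    have "1 \<le> savings t \<omega>" if "t \<le> T" for t
      unfolding savings_def using elim(1) that by (intro prod_ge_1) auto
    then show ?case using elim by (auto simp: regular_def)
  qed
qed

lemma regular_savings: "regular \<omega> \<Longrightarrow> t \<le> T \<Longrightarrow> 0 < savings t \<omega>"
  unfolding regular_def by (metis atMost_iff less_le_trans zero_less_one)

lemma regular_increment: "regular \<omega> \<Longrightarrow> t \<le> T \<Longrightarrow> increment Abid t \<omega> = increment Aask t \<omega>"
  by (auto simp: regular_def increment_def)

lemma regular_bid_le_ask:
  assumes "regular \<omega>" "t \<le> T"
  shows "bid t \<omega> \<le> ask t \<omega>"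
proof -
  have "Pbid t \<omega> \<le> Pask t \<omega>" using assms by (auto simp: regular_def)
  then show ?thesis
    using regular_savings[OF assms]
    by (auto simp: bid_def ask_def discounted_def less_eq_vec_def mult_left_mono)
qed

section \<open>Measurability of the discounted data\<close>

lemma subalgebra_F: "t \<le> T \<Longrightarrow> subalgebra M (F t)"
  using sets_F_mono[of t T] sets_F_horizon space_F by (auto simp: subalgebra_def)

lemma filtered_prob_spaceI:
  assumes "prob_space Q" "sets Q = sets M"
  shows "filtered_prob_space Q F T"
proof -
  interpret Q: prob_space Q by fact
  show ?thesis
    using subalgebra_F sets_F_mono sets_eq_imp_space_eq[OF assms(2)]
    by unfold_locales (auto simp: subalgebra_def assms(2))
qed

sublocale filtered_prob_space M F T
  by (rule filtered_prob_spaceI) (auto intro: prob_space_axioms)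

lemma savings_measurable[measurable]: "t \<le> T \<Longrightarrow> savings t \<in> borel_measurable (F t)"
  unfolding savings_def
  by (intro borel_measurable_prod borel_measurable_add borel_measurable_const)
    (auto intro: measurable_F_mono[OF _ _ adapted_rate])

lemma discounted_measurable:
  assumes "t \<le> T" and [measurable]: "X t \<in> borel_measurable (F t)"
  shows "discounted X t \<in> borel_measurable (F t)"
proof -
  note [measurable] = savings_measurable[OF assms(1)]
  show ?thesis unfolding discounted_def by measurable
qed

lemma Aask_measurable: "t \<le> T \<Longrightarrow> Aask t \<in> borel_measurable (F t)"
  using adapted_Aask[of t] Aask_0 by (cases t) (simp_all add: fun_eq_iff[of "Aask 0" "\<lambda>_. 0", THEN iffD2])

lemma Abid_measurable: "t \<le> T \<Longrightarrow> Abid t \<in> borel_measurable (F t)"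
  using adapted_Abid[of t] Abid_0 by (cases t) (simp_all add: fun_eq_iff[of "Abid 0" "\<lambda>_. 0", THEN iffD2])

lemma increment_measurable:
  fixes A :: "nat \<Rightarrow> 'a \<Rightarrow> real ^ 'n"
  assumes "t \<le> T" and A: "\<And>t. t \<le> T \<Longrightarrow> A t \<in> borel_measurable (F t)"
  shows "increment A t \<in> borel_measurable (F t)"
proof -
  have [measurable]: "A t \<in> borel_measurable (F t)" "A (t - 1) \<in> borel_measurable (F t)"
    using assms(1) A by (auto intro: measurable_F_mono[of "t - 1" t])
  show ?thesis unfolding increment_def by measurable
qed

lemma discounted_dividend_measurable:
  "t \<le> T \<Longrightarrow> discounted (increment Aask) t \<in> borel_measurable (F t)"
  "t \<le> T \<Longrightarrow> discounted (increment Abid) t \<in> borel_measurable (F t)"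
  by (auto intro!: discounted_measurable increment_measurable Aask_measurable Abid_measurable)

lemma gain_measurable: "t \<le> T \<Longrightarrow> gain t \<in> borel_measurable (F t)"
  unfolding gain_def
  by (intro borel_measurable_sum) (auto intro: measurable_F_mono[OF _ _ discounted_dividend_measurable(1)])

lemma ask_measurable: "t \<le> T \<Longrightarrow> ask t \<in> borel_measurable (F t)"
  unfolding ask_def
  by (intro borel_measurable_add gain_measurable discounted_measurable adapted_Pask)

lemma bid_measurable: "t \<le> T \<Longrightarrow> bid t \<in> borel_measurable (F t)"
  unfolding bid_def
  by (intro borel_measurable_add gain_measurable discounted_measurable adapted_Pbid)

lemma signed_value_ask_bid:
  "signed_value x (ask t \<omega>) (bid t \<omega>)
    = signed_value x (Pask t \<omega>) (Pbid t \<omega>) / savings t \<omega> + x \<bullet> gain t \<omega>"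
  by (simp add: ask_def bid_def discounted_def signed_value_add_prices signed_value_scale_prices
      divide_inverse mult.commute)

lemma signed_value_bid_ask:
  "signed_value x (bid t \<omega>) (ask t \<omega>)
    = signed_value x (Pbid t \<omega>) (Pask t \<omega>) / savings t \<omega> + x \<bullet> gain t \<omega>"
  by (simp add: ask_def bid_def discounted_def signed_value_add_prices signed_value_scale_prices
      divide_inverse mult.commute)

lemma regular_dividend_income:
  "regular \<omega> \<Longrightarrow> t \<le> T \<Longrightarrow> dividend_income \<phi> t \<omega> = snd (\<phi> t \<omega>) \<bullet> increment Aask t \<omega>"
  by (simp add: dividend_income_def regular_increment signed_value_same)

lemma gain_Suc: "gain (Suc n) \<omega> = gain n \<omega> + discounted (increment Aask) (Suc n) \<omega>"
  by (simp add: gain_def)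

text \<open>Pathwise accounting: discounted terminal wealth is initial value, minus all trades at
  cum-dividend prices, plus liquidation at those prices.\<close>

lemma discounted_terminal_value:
  assumes reg: "regular \<omega>" and "\<phi> 0 \<omega> = 0"
    and sf: "\<And>t. 1 \<le> t \<Longrightarrow> t < T \<Longrightarrow> savings t \<omega> * fst (increment \<phi> (t + 1) \<omega>)
        + signed_value (snd (increment \<phi> (t + 1) \<omega>)) (Pask t \<omega>) (Pbid t \<omega>) = dividend_income \<phi> t \<omega>"
  shows "value_process \<phi> T \<omega> / savings T \<omega>
    = value_process \<phi> 0 \<omega> + signed_value (snd (\<phi> T \<omega>)) (bid T \<omega>) (ask T \<omega>)
      - (\<Sum>t<T. signed_value (snd (\<phi> (Suc t) \<omega>) - snd (\<phi> t \<omega>)) (ask t \<omega>) (bid t \<omega>))"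
proof -
  \<comment> \<open>The invariant for the cash position. Cum-dividend prices overcharge the current
    holdings by the dividends paid so far, hence the correction by \<open>gain n\<close>.\<close>
  have cash: "fst (\<phi> (Suc n) \<omega>) = value_process \<phi> 0 \<omega> + snd (\<phi> (Suc n) \<omega>) \<bullet> gain n \<omega>
      - (\<Sum>t<Suc n. signed_value (snd (\<phi> (Suc t) \<omega>) - snd (\<phi> t \<omega>)) (ask t \<omega>) (bid t \<omega>))"
    if "Suc n \<le> T" for n
    using that
  proof (induction n)
    case 0
    then show ?case
      using reg assms(2) by (simp add: value_process_def signed_value_ask_bid gain_def regular_def)
  next
    case (Suc n)
    have B: "0 < savings (Suc n) \<omega>"
      using regular_savings[OF reg] Suc.prems by simp
    let ?x = "snd (\<phi> (Suc (Suc n)) \<omega>) - snd (\<phi> (Suc n) \<omega>)"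
    have "savings (Suc n) \<omega> * (fst (\<phi> (Suc (Suc n)) \<omega>) - fst (\<phi> (Suc n) \<omega>))
        + signed_value ?x (Pask (Suc n) \<omega>) (Pbid (Suc n) \<omega>)
        = snd (\<phi> (Suc n) \<omega>) \<bullet> increment Aask (Suc n) \<omega>"
      using sf[of "Suc n"] Suc.prems regular_dividend_income[OF reg, of "Suc n" \<phi>]
      by (simp add: increment_def[of \<phi>])
    then have "fst (\<phi> (Suc (Suc n)) \<omega>) - fst (\<phi> (Suc n) \<omega>)
        = (snd (\<phi> (Suc n) \<omega>) \<bullet> increment Aask (Suc n) \<omega>
          - signed_value ?x (Pask (Suc n) \<omega>) (Pbid (Suc n) \<omega>)) / savings (Suc n) \<omega>"
      using B by (simp add: field_simps)
    then have "fst (\<phi> (Suc (Suc n)) \<omega>) = fst (\<phi> (Suc n) \<omega>)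
        + snd (\<phi> (Suc n) \<omega>) \<bullet> discounted (increment Aask) (Suc n) \<omega>
        - (signed_value ?x (ask (Suc n) \<omega>) (bid (Suc n) \<omega>) - ?x \<bullet> gain (Suc n) \<omega>)"
      by (simp add: signed_value_ask_bid discounted_def divide_inverse algebra_simps)
    then show ?case
      using Suc.IH Suc.prems by (simp add: gain_Suc inner_diff_left inner_add_right)
  qed
  obtain n where n: "T = Suc n" using horizon by (cases T) auto
  have B: "0 < savings T \<omega>" using regular_savings[OF reg] by simp
  \<comment> \<open>The terminal value includes the dividend at \<open>T\<close>, which lifts the
    correction from \<open>gain n\<close> to \<open>gain T\<close>.\<close>
  have "value_process \<phi> T \<omega> / savings T \<omega> = fst (\<phi> T \<omega>)
      + signed_value (snd (\<phi> T \<omega>)) (bid T \<omega>) (ask T \<omega>) - snd (\<phi> T \<omega>) \<bullet> gain T \<omega>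
      + snd (\<phi> T \<omega>) \<bullet> discounted (increment Aask) T \<omega>"
    using B horizon regular_dividend_income[OF reg order_refl, of \<phi>]
    by (simp add: value_process_def signed_value_bid_ask discounted_def field_simps)
  then show ?thesis
    using cash[of n] n by (simp add: gain_Suc inner_add_right)
qed

lemma strategy_terminal_value:
  assumes "\<phi> \<in> strategies"
  shows "AE \<omega> in M. value_process \<phi> T \<omega> / savings T \<omega>
    = value_process \<phi> 0 \<omega> + signed_value (snd (\<phi> T \<omega>)) (bid T \<omega>) (ask T \<omega>)
      - (\<Sum>t<T. signed_value (snd (\<phi> (Suc t) \<omega>) - snd (\<phi> t \<omega>)) (ask t \<omega>) (bid t \<omega>))"
proof -
  have "AE \<omega> in M. \<forall>t\<in>{1..<T}. savings t \<omega> * fst (increment \<phi> (t + 1) \<omega>)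
        + signed_value (snd (increment \<phi> (t + 1) \<omega>)) (Pask t \<omega>) (Pbid t \<omega>) = dividend_income \<phi> t \<omega>"
    using assms by (intro AE_finite_allI) (auto simp: strategies_def self_financing_def)
  with AE_regular show ?thesis
    by eventually_elim
      (rule discounted_terminal_value, use assms in \<open>auto simp: strategies_def trading_strategy_def\<close>)
qed

section \<open>From a pricing system to no arbitrage\<close>

lemma pricing_system_AE:
  assumes "Q \<in> pricing_measures"
  shows "(AE \<omega> in Q. P \<omega>) \<longleftrightarrow> (AE \<omega> in M. P \<omega>)"
  using assms absolutely_continuous_AE[of Q M P] absolutely_continuous_AE[of M Q P]
  by (auto simp: pricing_measures_def)

lemma no_arbitrage_of_pricing_system:
  assumes "consistent_pricing_system Q P A X"
  shows no_arbitrage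
  unfolding no_arbitrage_def
proof (intro ballI impI)
  fix \<phi> assume \<phi>: "\<phi> \<in> strategies"
    and V: "(AE \<omega> in M. value_process \<phi> 0 \<omega> = 0) \<and> (AE \<omega> in M. 0 \<le> value_process \<phi> T \<omega>)"
  have Q: "Q \<in> pricing_measures" and mart: "martingale_upto Q F T X"
    using assms by (auto simp: consistent_pricing_system_def)
  interpret Q: filtered_prob_space Q F T
    using Q by (intro filtered_prob_spaceI) (auto simp: pricing_measures_def)
  have "AE \<omega> in M. \<forall>t\<in>{..T}. discounted Pbid t \<omega> \<le> P t \<omega> \<and> P t \<omega> \<le> discounted Pask t \<omega>"
    "AE \<omega> in M. \<forall>t\<in>{1..T}. discounted (increment Aask) t \<omega> \<le> A t \<omega> \<and> A t \<omega> \<le> discounted (increment Abid) t \<omega>"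
    "AE \<omega> in M. \<forall>t\<in>{..T}. X t \<omega> = P t \<omega> + (\<Sum>u=1..t. A u \<omega>)"
    using assms by (auto simp: consistent_pricing_system_def intro!: AE_finite_allI)
  with AE_regular have between: "AE \<omega> in M. \<forall>t\<le>T. bid t \<omega> \<le> X t \<omega> \<and> X t \<omega> \<le> ask t \<omega>"
  proof eventually_elim
    case (elim \<omega>)
    \<comment> \<open>With common dividends \<open>A\<close> is squeezed to the discounted dividend,
      so the martingale lies between the cum-dividend bid and ask.\<close>
    have "A t \<omega> = discounted (increment Aask) t \<omega>" if "t \<in> {1..T}" for t
    proof -
      have "discounted (increment Abid) t \<omega> = discounted (increment Aask) t \<omega>"
        using that regular_increment[OF elim(1), of t] by (simp add: discounted_def)
      then show ?thesis using bspec[OF elim(3) that] by (intro order.antisym) simp_all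
    qed
    then have "(\<Sum>u=1..t. A u \<omega>) = gain t \<omega>" if "t \<le> T" for t
      unfolding gain_def using that by (intro sum.cong) auto
    then show ?case
      using elim(2,4) by (auto simp: bid_def ask_def)
  qed
  define \<theta> where "\<theta> t \<omega> = snd (\<phi> t \<omega>)" for t \<omega>
  let ?G = "\<lambda>\<omega>. \<Sum>t<T. \<theta> (Suc t) \<omega> \<bullet> (X (Suc t) \<omega> - X t \<omega>)"
  \<comment> \<open>Trading and liquidating at the frictionless price \<open>X\<close> is never
    worse; summation by parts then turns the bound into a martingale transform.\<close>
  have V_le: "AE \<omega> in M. value_process \<phi> T \<omega> / savings T \<omega> \<le> ?G \<omega>"
    using strategy_terminal_value[OF \<phi>] between conjunct1[OF V]
  proof eventually_elim
    case (elim \<omega>)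
    have "signed_value (snd (\<phi> T \<omega>)) (bid T \<omega>) (ask T \<omega>) \<le> \<theta> T \<omega> \<bullet> X T \<omega>"
      using inner_le_signed_value[of "bid T \<omega>" "X T \<omega>" "ask T \<omega>" "- snd (\<phi> T \<omega>)"] elim(2)
      by (simp add: signed_value_minus \<theta>_def)
    moreover have "(\<Sum>t<T. (\<theta> (Suc t) \<omega> - \<theta> t \<omega>) \<bullet> X t \<omega>)
        \<le> (\<Sum>t<T. signed_value (snd (\<phi> (Suc t) \<omega>) - snd (\<phi> t \<omega>)) (ask t \<omega>) (bid t \<omega>))"
      unfolding \<theta>_def using elim(2) by (intro sum_mono inner_le_signed_value) auto
    moreover have "\<theta> 0 \<omega> = 0"
      using \<phi> by (simp add: \<theta>_def strategies_def trading_strategy_def)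
    ultimately show ?case
      using elim(1,3) sum_by_parts_inner[of "\<lambda>t. \<theta> t \<omega>" T "\<lambda>t. X t \<omega>"] by simp
  qed
  have "AE \<omega> in M. 0 \<le> ?G \<omega>"
    using V_le conjunct2[OF V] AE_regular
  proof eventually_elim
    case (elim \<omega>)
    show ?case
      by (rule order_trans[OF divide_nonneg_pos[OF elim(2) regular_savings[OF elim(3) order_refl]] elim(1)])
  qed
  then have "AE \<omega> in Q. ?G \<omega> = 0"
  proof (intro Q.nonneg_martingale_transform_AE_0[OF mart])
    show "\<theta> (Suc t) \<in> borel_measurable (F t)" if "Suc t \<le> T" for t
    proof -
      have "\<phi> (Suc t) \<in> borel_measurable (F t)"
        using \<phi> that by (force simp: strategies_def trading_strategy_def)
      then show ?thesis unfolding \<theta>_def by measurable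
    qed
  qed (simp_all add: pricing_system_AE[OF Q])
  then have "AE \<omega> in M. ?G \<omega> = 0"
    by (simp add: pricing_system_AE[OF Q])
  with V_le conjunct2[OF V] AE_regular show "AE \<omega> in M. value_process \<phi> T \<omega> = 0"
  proof eventually_elim
    case (elim \<omega>)
    then show ?case
      using regular_savings[OF elim(3) order_refl] by (simp add: divide_le_0_iff)
  qed
qed

text \<open>The trades before \<open>T\<close> become a self-financing strategy from zero, and the
  trade at \<open>T\<close> closes it, so it is the liquidation. NA makes the terminal value vanish,
  EF makes the strategy vanish, and the trades are differences of its positions.\<close>

lemma round_trip_AE_0:
  assumes NA: no_arbitrage and EF: efficient_friction
    and \<xi>: "\<And>t. t \<le> T \<Longrightarrow> \<xi> t \<in> borel_measurable (F t)"
    and cost: "AE \<omega> in M. (\<Sum>t\<le>T. signed_value (\<xi> t \<omega>) (ask t \<omega>) (bid t \<omega>)) \<le> 0"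
    and closed: "AE \<omega> in M. (\<Sum>t\<le>T. \<xi> t \<omega>) = 0"
    and "t \<le> T"
  shows "AE \<omega> in M. \<xi> t \<omega> = 0"
proof -
  \<comment> \<open>Only trades strictly before \<open>t\<close> count, since the position at
    \<open>t\<close> is held from \<open>t - 1\<close>; this gives predictability.\<close>
  define h where "h t \<omega> = (\<Sum>s<t. \<xi> s \<omega>)" for t \<omega>
  define income where "income t \<omega> = signed_value (h t \<omega>) (increment Aask t \<omega>) (increment Abid t \<omega>)" for t \<omega>
  \<comment> \<open>The value at 0 is the convention for strategies. The value at 1 makes the
    initial value zero, and later values solve the self-financing equation for cash.\<close>
  define c where "c = rec_nat (\<lambda>\<omega>. 0) (\<lambda>n c \<omega>. if n = 0 then - signed_value (\<xi> 0 \<omega>) (Pask 0 \<omega>) (Pbid 0 \<omega>)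
      else c \<omega> + (income n \<omega> - signed_value (\<xi> n \<omega>) (Pask n \<omega>) (Pbid n \<omega>)) / savings n \<omega>)"
  have c_0: "c 0 \<omega> = 0" and c_1: "c (Suc 0) \<omega> = - signed_value (\<xi> 0 \<omega>) (Pask 0 \<omega>) (Pbid 0 \<omega>)"
    and c_Suc: "0 < n \<Longrightarrow> c (Suc n) \<omega>
      = c n \<omega> + (income n \<omega> - signed_value (\<xi> n \<omega>) (Pask n \<omega>) (Pbid n \<omega>)) / savings n \<omega>" for n \<omega>
    by (simp_all add: c_def)
  define \<phi> where "\<phi> t \<omega> = (c t \<omega>, h t \<omega>)" for t \<omega>
  have h_Suc: "h (Suc t) \<omega> = h t \<omega> + \<xi> t \<omega>" for t \<omega>
    by (simp add: h_def)
  have h_measurable: "h (Suc t) \<in> borel_measurable (F t)" if "t \<le> T" for t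
    unfolding h_def using that by (intro borel_measurable_sum) (auto intro: measurable_F_mono[OF _ _ \<xi>])
  have c_measurable: "c (Suc t) \<in> borel_measurable (F t)" if "t \<le> T" for t
    using that
  proof (induction t)
    case 0
    note [measurable] = \<xi>[OF 0] adapted_Pask[OF 0] adapted_Pbid[OF 0]
    show ?case unfolding c_1 by measurable
  next
    case (Suc n)
    note [measurable] = \<xi>[OF Suc.prems] adapted_Pask[OF Suc.prems] adapted_Pbid[OF Suc.prems]
      savings_measurable[OF Suc.prems] increment_measurable[OF Suc.prems Aask_measurable]
      increment_measurable[OF Suc.prems Abid_measurable]
    have [measurable]: "c (Suc n) \<in> borel_measurable (F (Suc n))" "h (Suc n) \<in> borel_measurable (F (Suc n))"
      using Suc h_measurable[of n] by (auto intro: measurable_F_mono[of n "Suc n"])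
    show ?case unfolding c_Suc[OF zero_less_Suc] income_def by measurable
  qed
  have \<phi>: "\<phi> \<in> strategies"
    unfolding strategies_def trading_strategy_def self_financing_def
  proof (intro CollectI conjI ballI allI)
    show "\<phi> 0 \<omega> = 0" for \<omega>
      by (simp add: \<phi>_def c_0 h_def zero_prod_def)
    show "\<phi> t \<in> borel_measurable (F (t - 1))" if t: "t \<in> {1..T}" for t
    proof -
      obtain n where "t = Suc n" "n \<le> T" using t by (cases t) auto
      then have [measurable]: "c t \<in> borel_measurable (F (t - 1))" "h t \<in> borel_measurable (F (t - 1))"
        using c_measurable h_measurable by auto
      show ?thesis unfolding \<phi>_def by measurable
    qed
    show "AE \<omega> in M. savings t \<omega> * fst (increment \<phi> (t + 1) \<omega>)
          + signed_value (snd (increment \<phi> (t + 1) \<omega>)) (Pask t \<omega>) (Pbid t \<omega>)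
        = dividend_income \<phi> t \<omega>" if "t \<in> {1..<T}" for t
      using AE_regular
    proof eventually_elim
      case (elim \<omega>)
      then show ?case
        using that regular_savings[of \<omega> t]
        by (simp add: increment_def[of \<phi>] \<phi>_def c_Suc h_Suc dividend_income_def income_def)
    qed
  qed
  have V_0: "value_process \<phi> 0 \<omega> = 0" for \<omega>
    by (simp add: value_process_def \<phi>_def c_1 h_def)
  have h_end: "AE \<omega> in M. h (Suc T) \<omega> = 0"
    using closed by (simp add: h_def lessThan_Suc_atMost)
  have "AE \<omega> in M. 0 \<le> value_process \<phi> T \<omega>"
    using strategy_terminal_value[OF \<phi>] cost h_end AE_regular
  proof eventually_elim
    case (elim \<omega>)
    have "h T \<omega> = - \<xi> T \<omega>"
      using elim(3) by (simp add: h_Suc eq_neg_iff_add_eq_0)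
    then have "value_process \<phi> T \<omega> / savings T \<omega> = - (\<Sum>t\<le>T. signed_value (\<xi> t \<omega>) (ask t \<omega>) (bid t \<omega>))"
      unfolding elim(1) V_0 lessThan_Suc_atMost[symmetric]
      by (simp add: \<phi>_def h_Suc signed_value_minus)
    then have "0 \<le> value_process \<phi> T \<omega> / savings T \<omega>"
      using elim(2) by simp
    then show ?case
      using regular_savings[OF elim(4) order_refl] by (simp add: zero_le_divide_iff)
  qed
  then have "AE \<omega> in M. value_process \<phi> T \<omega> = 0"
    using NA \<phi> V_0 by (simp add: no_arbitrage_def)
  then have "\<forall>t\<in>{1..T}. AE \<omega> in M. \<phi> t \<omega> = 0"
    using EF \<phi> V_0 unfolding efficient_friction_def by blast
  then have h: "AE \<omega> in M. h t \<omega> = 0" if "t \<le> Suc T" for t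
  proof -
    consider "t = 0" | "t \<in> {1..T}" | "t = Suc T" using \<open>t \<le> Suc T\<close> by force
    then show ?thesis
    proof cases
      case 2
      then have "AE \<omega> in M. \<phi> t \<omega> = 0"
        using \<open>\<forall>t\<in>{1..T}. AE \<omega> in M. \<phi> t \<omega> = 0\<close> by blast
      then show ?thesis by eventually_elim (simp add: \<phi>_def zero_prod_def)
    qed (use h_end in \<open>auto simp: h_def\<close>)
  qed
  have "AE \<omega> in M. h t \<omega> = 0" "AE \<omega> in M. h (Suc t) \<omega> = 0"
    using h \<open>t \<le> T\<close> by auto
  then show ?thesis
    by eventually_elim (simp add: h_Suc)
qed

end

section \<open>Equivalence of pricing systems and absence of arbitrage\<close>

lemma signed_value_axis: "signed_value (axis j 1) p q = p $ j"
  by (simp add: signed_value_def axis_def if_distrib[of "\<lambda>x. x * _"] cong: if_cong)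

lemma signed_value_indicator_axis:
  "signed_value (indicator B \<omega> *\<^sub>R axis j 1) p q = indicator B \<omega> * p $ j"
  "signed_value (- (indicator B \<omega> *\<^sub>R axis j 1)) p q = - (indicator B \<omega> * q $ j)"
  by (simp_all add: signed_value_minus signed_value_scale signed_value_axis)

lemma AE_density_pos:
  fixes g :: "'a \<Rightarrow> real"
  assumes "g \<in> borel_measurable M" "\<And>\<omega>. 0 < g \<omega>"
  shows "(AE \<omega> in density M g. P \<omega>) \<longleftrightarrow> (AE \<omega> in M. P \<omega>)"
  using assms by (subst AE_density) auto

lemma absolutely_continuous_of_AE:
  assumes "sets N = sets M" "\<And>P. (AE \<omega> in M. P \<omega>) \<Longrightarrow> (AE \<omega> in N. P \<omega>)"
  shows "absolutely_continuous M N"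
  unfolding absolutely_continuous_def
proof
  fix A assume "A \<in> null_sets M"
  then have "AE \<omega> in N. \<omega> \<notin> A" "A \<in> sets N"
    using assms AE_not_in[of A M] by auto
  then show "A \<in> null_sets N" by (simp add: AE_iff_null_sets)
qed

context common_dividend_market
begin

text \<open>The cone is separated under a reweighted measure \<open>N\<close>, whose weight ensures
  integrability of all prices. The cash component of the separator gives \<open>Q\<close>;
  conditional expectations of the quotient give the cum-dividend price.\<close>

lemma pricing_system_exists:
  assumes NA: no_arbitrage and EF: efficient_friction
  shows "\<exists>Q P A X. consistent_pricing_system Q P A X"
proof -
  define H where "H t \<omega> x = signed_value x (ask t \<omega>) (bid t \<omega>)" for t \<omega> and x :: "real ^ 'n"
  interpret costs: trading_costs M F T H
  proof
    show "sets (F t) \<subseteq> sets M" if "t \<le> T" for t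
      using subalgebra_F[OF that] by (simp add: subalgebra_def)
    show "(\<lambda>\<omega>. H t \<omega> (f \<omega>)) \<in> borel_measurable (F t)" if "t \<le> T" "f \<in> borel_measurable (F t)" for t f
      unfolding H_def using that ask_measurable bid_measurable by measurable
    show "continuous_on UNIV (H t \<omega>)" for t \<omega>
      unfolding H_def by (rule signed_value_continuous)
    show "H t \<omega> (c *\<^sub>R x) = c * H t \<omega> x" if "0 \<le> c" for c t \<omega> x
      unfolding H_def by (rule signed_value_scale[OF that])
    show "AE \<omega> in M. \<forall>x y. H t \<omega> (x + y) \<le> H t \<omega> x + H t \<omega> y" if "t \<le> T" for t
      using AE_regular unfolding H_def
      by eventually_elim (auto intro!: signed_value_add_le regular_bid_le_ask that)
    show "AE \<omega> in M. \<xi> t \<omega> = 0"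
      if "\<And>t. t \<le> T \<Longrightarrow> \<xi> t \<in> borel_measurable (F t)" "AE \<omega> in M. (\<Sum>t\<le>T. H t \<omega> (\<xi> t \<omega>)) \<le> 0"
        "AE \<omega> in M. (\<Sum>t\<le>T. \<xi> t \<omega>) = 0" "t \<le> T" for \<xi> t
      by (rule round_trip_AE_0[OF NA EF that(1) that(2)[unfolded H_def] that(3,4)])
  qed
  let ?norms = "\<lambda>t \<omega>. (norm (discounted Pask t \<omega>))\<^sup>2 + (norm (discounted Pbid t \<omega>))\<^sup>2
      + (norm (discounted (increment Aask) t \<omega>))\<^sup>2 + (norm (discounted (increment Abid) t \<omega>))\<^sup>2"
  \<comment> \<open>The weight makes all discounted prices and dividends square integrable under
    \<open>N\<close> and leaves the null sets, hence the cone, unchanged.\<close>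
  define w where "w \<omega> = 1 / (1 + (\<Sum>t\<le>T. ?norms t \<omega>))" for \<omega>
  note F_M = measurable_from_F
  have disc_measurable: "discounted Pask t \<in> borel_measurable M" "discounted Pbid t \<in> borel_measurable M"
    "discounted (increment Aask) t \<in> borel_measurable M" "discounted (increment Abid) t \<in> borel_measurable M"
    if "t \<le> T" for t
    using that by (auto intro!: F_M[OF that] discounted_measurable discounted_dividend_measurable adapted_Pask adapted_Pbid)
  have sum_nonneg: "0 \<le> (\<Sum>t\<le>T. ?norms t \<omega>)" for \<omega>
    by (intro sum_nonneg) auto
  have "?norms t \<in> borel_measurable M" if "t \<le> T" for t
  proof -
    note [measurable] = disc_measurable[OF that]
    show ?thesis by measurable
  qed
  then have [measurable]: "(\<lambda>\<omega>. \<Sum>t\<le>T. ?norms t \<omega>) \<in> borel_measurable M"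
    by (intro borel_measurable_sum) auto
  have w_measurable[measurable]: "w \<in> borel_measurable M"
    unfolding w_def by measurable
  have w: "0 < w \<omega>" "w \<omega> \<le> 1" for \<omega>
    using sum_nonneg[of \<omega>] by (auto simp: w_def)
  have w_le: "w \<omega> * ?norms t \<omega> \<le> 1" if "t \<le> T" for t \<omega>
  proof -
    have "?norms t \<omega> \<le> (\<Sum>t\<le>T. ?norms t \<omega>)"
      using that by (intro member_le_sum) auto
    then show ?thesis
      using sum_nonneg[of \<omega>] by (simp add: w_def divide_le_eq)
  qed
  define N where "N = density M (\<lambda>\<omega>. ennreal (w \<omega>))"
  have sets_N[measurable_cong]: "sets N = sets M" and space_N: "space N = space M"
    by (simp_all add: N_def)
  have AE_N: "(AE \<omega> in N. P \<omega>) \<longleftrightarrow> (AE \<omega> in M. P \<omega>)" for P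
    unfolding N_def by (rule AE_density_pos[OF w_measurable w(1)])
  have N_finite: "finite_measure N"
  proof
    have "emeasure N (space N) = (\<integral>\<^sup>+\<omega>. ennreal (w \<omega>) \<partial>M)"
      by (simp add: N_def emeasure_density cong: nn_integral_cong)
    also have "\<dots> \<le> (\<integral>\<^sup>+\<omega>. 1 \<partial>M)"
      using w by (intro nn_integral_mono) auto
    finally show "emeasure N (space N) \<noteq> \<infinity>"
      by (auto simp: emeasure_space_1 top_unique)
  qed
  have N_square: "integrable N (\<lambda>\<omega>. (norm (D \<omega>))\<^sup>2)"
    if [measurable]: "D \<in> borel_measurable M" and "\<And>\<omega>. w \<omega> * (norm (D \<omega>))\<^sup>2 \<le> 1" for D :: "'a \<Rightarrow> real ^ 'n"
  proof -
    have "integrable M (\<lambda>\<omega>. w \<omega> *\<^sub>R (norm (D \<omega>))\<^sup>2)"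
      using that(2) w(1) by (intro integrable_const_bound[where B=1]) (auto simp: less_imp_le abs_mult)
    then show ?thesis
      unfolding N_def using w(1) by (subst integrable_density) (auto simp: less_imp_le)
  qed
  interpret N: closed_solid_cone N costs.attainable
  proof (intro closed_solid_cone.intro closed_solid_cone_axioms.intro N_finite)
    show "X \<in> borel_measurable N" if "X \<in> costs.attainable" for X
      using that by (simp add: costs.attainable_def measurable_cong_sets[OF sets_N refl])
    show "A \<in> null_sets N" if "A \<in> sets N" "(\<lambda>\<omega>. (indicator A \<omega>, 0)) \<in> costs.attainable" for A
      using costs.attainable_cash_null[of A] that by (simp add: sets_N AE_iff_null_sets AE_N)
    show "(\<lambda>\<omega>. 0) \<in> costs.attainable"
      using costs.attainable_trade[of 0 "\<lambda>_. 0"] by (simp add: costs.H_zero zero_prod_def)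
  qed (auto simp: AE_N measurable_cong_sets[OF sets_N refl]
      intro: costs.attainable_scale costs.attainable_add costs.attainable_mono costs.attainable_closed)
  obtain Z where Z_measurable[measurable]: "Z \<in> borel_measurable N"
    and Z_square: "integrable N (\<lambda>\<omega>. (norm (Z \<omega>))\<^sup>2)"
    and Z_pos: "\<And>\<omega>. 0 < fst (Z \<omega>)"
    and Z_sep: "\<forall>Y\<in>costs.attainable. (\<exists>K. \<forall>\<omega>. norm (Y \<omega>) \<le> K) \<longrightarrow> (LINT \<omega>|N. Z \<omega> \<bullet> Y \<omega>) \<le> 0"
    by (rule N.separating_density) (rule that)
  have Z_le: "(LINT \<omega>|N. Z \<omega> \<bullet> Y \<omega>) \<le> 0" if "Y \<in> costs.attainable" "\<And>\<omega>. norm (Y \<omega>) \<le> K" for Y K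
    using Z_sep that by blast
  have Z_int: "integrable N Z"
    by (rule N.integrable_of_norm_square[OF Z_measurable Z_square])
  have fst_int: "integrable N (\<lambda>\<omega>. fst (Z \<omega>))" and snd_int: "integrable N (\<lambda>\<omega>. snd (Z \<omega>))"
    using Z_int by (auto intro: integrable_bounded_linear bounded_linear_fst bounded_linear_snd)
  define c where "c = (LINT \<omega>|N. fst (Z \<omega>))"
  have "c \<noteq> 0"
  proof
    assume "c = 0"
    then have "AE \<omega> in N. fst (Z \<omega>) = 0"
      using integral_nonneg_eq_0_iff_AE[OF fst_int] Z_pos by (simp add: c_def less_imp_le)
    then have "AE \<omega> in M. False"
      unfolding AE_N by eventually_elim (metis Z_pos less_irrefl)
    then show False by simp
  qed
  moreover have "0 \<le> c"
    unfolding c_def using Z_pos by (intro Bochner_Integration.integral_nonneg) (simp add: less_imp_le)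
  ultimately have c: "0 < c" by simp
  define Q where "Q = density N (\<lambda>\<omega>. ennreal (fst (Z \<omega>) / c))"
  have q_measurable[measurable]: "(\<lambda>\<omega>. fst (Z \<omega>) / c) \<in> borel_measurable N"
    by measurable
  have q_pos: "0 < fst (Z \<omega>) / c" for \<omega>
    using Z_pos c by simp
  have sets_Q[measurable_cong]: "sets Q = sets M"
    by (simp add: Q_def sets_N)
  have AE_Q: "(AE \<omega> in Q. P \<omega>) \<longleftrightarrow> (AE \<omega> in M. P \<omega>)" for P
    unfolding Q_def AE_density_pos[OF q_measurable q_pos] by (rule AE_N)
  have Q_prob: "prob_space Q"
  proof
    have "emeasure Q (space Q) = (\<integral>\<^sup>+\<omega>. ennreal (fst (Z \<omega>) / c) \<partial>N)"
      by (simp add: Q_def emeasure_density cong: nn_integral_cong)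
    also have "\<dots> = ennreal (LINT \<omega>|N. fst (Z \<omega>) / c)"
      using fst_int q_pos by (intro nn_integral_eq_integral) (auto simp: less_imp_le)
    also have "\<dots> = 1"
      using c by (simp add: c_def)
    finally show "emeasure Q (space Q) = 1" .
  qed
  interpret Q: filtered_prob_space Q F T
    by (rule filtered_prob_spaceI[OF Q_prob sets_Q])
  have Q_integrable: "integrable Q f \<longleftrightarrow> integrable N (\<lambda>\<omega>. (fst (Z \<omega>) / c) *\<^sub>R f \<omega>)"
    if "f \<in> borel_measurable M" for f :: "'a \<Rightarrow> real ^ 'n"
    unfolding Q_def using that q_pos
    by (intro integrable_density q_measurable) (auto simp: less_imp_le measurable_cong_sets[OF sets_N refl])
  have Q_integral: "integral\<^sup>L Q f = (LINT \<omega>|N. fst (Z \<omega>) / c * f \<omega>)"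
    if "f \<in> borel_measurable M" for f :: "'a \<Rightarrow> real"
    unfolding Q_def using that q_pos integral_density[of f N "\<lambda>\<omega>. fst (Z \<omega>) / c"]
    by (auto simp: less_imp_le measurable_cong_sets[OF sets_N refl])
  \<comment> \<open>The density of \<open>Q\<close> and \<open>D\<close> are both square integrable
    under \<open>N\<close>, so their product is integrable.\<close>
  have Q_int: "integrable Q D"
    if D[measurable]: "D \<in> borel_measurable M" and "\<And>\<omega>. w \<omega> * (norm (D \<omega>))\<^sup>2 \<le> 1"
    for D :: "'a \<Rightarrow> real ^ 'n"
    unfolding Q_integrable[OF D]
  proof (rule Bochner_Integration.integrable_bound)
    show "integrable N (\<lambda>\<omega>. ((norm (Z \<omega>))\<^sup>2 + (norm (D \<omega>))\<^sup>2) / c)"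
      using Z_square N_square[OF that] by simp
    have "norm ((fst z / c) *\<^sub>R d) \<le> norm (((norm z)\<^sup>2 + (norm d)\<^sup>2) / c)"
      for z :: "real \<times> (real ^ 'n)" and d :: "real ^ 'n"
    proof -
      have "\<bar>fst z\<bar> * norm d \<le> norm z * norm d"
        using norm_fst_le[of "fst z" "snd z"] by (intro mult_right_mono) auto
      also have "\<dots> \<le> (norm z)\<^sup>2 + (norm d)\<^sup>2"
        using sum_squares_bound[of "norm z" "norm d"] mult_nonneg_nonneg[OF norm_ge_zero[of z] norm_ge_zero[of d]]
        by linarith
      finally show ?thesis
        using c by (simp add: divide_right_mono)
    qed
    then show "AE \<omega> in N. norm ((fst (Z \<omega>) / c) *\<^sub>R D \<omega>) \<le> norm (((norm (Z \<omega>))\<^sup>2 + (norm (D \<omega>))\<^sup>2) / c)"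
      by blast
  qed measurable
  have sq_le: "w \<omega> * (norm (discounted Pask t \<omega>))\<^sup>2 \<le> 1" "w \<omega> * (norm (discounted Pbid t \<omega>))\<^sup>2 \<le> 1"
    "w \<omega> * (norm (discounted (increment Aask) t \<omega>))\<^sup>2 \<le> 1"
    "w \<omega> * (norm (discounted (increment Abid) t \<omega>))\<^sup>2 \<le> 1" if "t \<le> T" for t \<omega>
    by (rule order_trans[OF mult_left_mono w_le[OF that]], use w(1) in \<open>auto simp: less_imp_le\<close>)+
  have Q_pricing: "Q \<in> pricing_measures"
    unfolding pricing_measures_def
    by (auto intro!: Q_prob sets_Q absolutely_continuous_of_AE Q_int disc_measurable sq_le simp: AE_Q sets_Q)
  \<comment> \<open>The terminal price in units of cash: dividing by the cash component turns
    pairings with \<open>Z\<close> under \<open>N\<close> into expectations under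
    \<open>Q\<close>.\<close>
  define \<zeta> where "\<zeta> \<omega> = snd (Z \<omega>) /\<^sub>R fst (Z \<omega>)" for \<omega>
  have \<zeta>_measurable[measurable]: "\<zeta> \<in> borel_measurable M"
  proof -
    have "\<zeta> \<in> borel_measurable N" unfolding \<zeta>_def by measurable
    then show ?thesis by (simp add: measurable_cong_sets[OF sets_N refl])
  qed
  have "integrable N (\<lambda>\<omega>. (fst (Z \<omega>) / c) *\<^sub>R \<zeta> \<omega>)"
  proof -
    have "(fst (Z \<omega>) / c) *\<^sub>R \<zeta> \<omega> = (1 / c) *\<^sub>R snd (Z \<omega>)" for \<omega>
      using Z_pos[of \<omega>] by (simp add: \<zeta>_def)
    then show ?thesis using snd_int by simp
  qed
  then have "integrable Q \<zeta>" by (simp add: Q_integrable)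
  then have \<zeta>_int: "integrable Q (\<lambda>\<omega>. \<zeta> \<omega> $ j)" for j
    using integrable_inner_left[of "axis j 1" Q \<zeta>] by (simp add: inner_axis)
  \<comment> \<open>Buying one unit of security \<open>j\<close> on \<open>B\<close>, or selling one
    on \<open>B'\<close>, at time \<open>t\<close>. The bounds on the prices keep these portfolios
    bounded, as the separation inequality requires.\<close>
  have trade_le: "(LINT \<omega>|Q. indicator B \<omega> * (\<zeta> \<omega> $ j - ask t \<omega> $ j)) \<le> 0"
    "(LINT \<omega>|Q. indicator B' \<omega> * (- \<zeta> \<omega> $ j - (- bid t \<omega> $ j))) \<le> 0"
    if t: "t \<le> T" and B[measurable]: "B \<in> sets (F t)" and K: "\<And>\<omega>. \<omega> \<in> B \<Longrightarrow> \<bar>ask t \<omega> $ j\<bar> \<le> K"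
      and B'[measurable]: "B' \<in> sets (F t)" and K': "\<And>\<omega>. \<omega> \<in> B' \<Longrightarrow> \<bar>- bid t \<omega> $ j\<bar> \<le> K'"
    for t B B' K K' and j :: 'n
  proof -
    have [measurable]: "ask t \<in> borel_measurable M" "bid t \<in> borel_measurable M"
        "B \<in> sets M" "B' \<in> sets M"
      using F_M[OF t] ask_measurable[OF t] bid_measurable[OF t] B B' subalgebra_F[OF t]
      by (auto simp: subalgebra_def)
    let ?f = "\<lambda>\<omega>. indicator B \<omega> *\<^sub>R axis j 1 :: real ^ 'n"
    let ?f' = "\<lambda>\<omega>. - (indicator B' \<omega> *\<^sub>R axis j 1) :: real ^ 'n"
    have H: "H t \<omega> (?f \<omega>) = indicator B \<omega> * ask t \<omega> $ j"
      "H t \<omega> (?f' \<omega>) = - (indicator B' \<omega> * bid t \<omega> $ j)" for \<omega>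
      by (simp_all only: H_def signed_value_indicator_axis)
    have "(LINT \<omega>|N. Z \<omega> \<bullet> (- H t \<omega> (?f \<omega>), ?f \<omega>)) \<le> 0"
    proof (rule Z_le[OF costs.attainable_trade[OF t]])
      show "norm (- H t \<omega> (?f \<omega>), ?f \<omega>) \<le> \<bar>K\<bar> + 1" for \<omega>
        unfolding H using K[of \<omega>]
        by (intro order_trans[OF norm_Pair_le]) (auto simp: norm_axis_1 indicator_def)
    qed measurable
    then show "(LINT \<omega>|Q. indicator B \<omega> * (\<zeta> \<omega> $ j - ask t \<omega> $ j)) \<le> 0"
    proof (subst Q_integral)
      have "fst (Z \<omega>) / c * (indicator B \<omega> * (\<zeta> \<omega> $ j - ask t \<omega> $ j))
          = (Z \<omega> \<bullet> (- H t \<omega> (?f \<omega>), ?f \<omega>)) / c" for \<omega>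
        using Z_pos[of \<omega>] c
        unfolding H by (simp add: \<zeta>_def inner_prod_def inner_axis field_simps)
      then show "(LINT \<omega>|N. fst (Z \<omega>) / c * (indicator B \<omega> * (\<zeta> \<omega> $ j - ask t \<omega> $ j))) \<le> 0"
        if "(LINT \<omega>|N. Z \<omega> \<bullet> (- H t \<omega> (?f \<omega>), ?f \<omega>)) \<le> 0"
        using that c by (simp add: divide_le_0_iff)
    qed measurable
    have "(LINT \<omega>|N. Z \<omega> \<bullet> (- H t \<omega> (?f' \<omega>), ?f' \<omega>)) \<le> 0"
    proof (rule Z_le[OF costs.attainable_trade[OF t]])
      show "norm (- H t \<omega> (?f' \<omega>), ?f' \<omega>) \<le> \<bar>K'\<bar> + 1" for \<omega>
        unfolding H using K'[of \<omega>]
        by (intro order_trans[OF norm_Pair_le]) (auto simp: norm_axis_1 indicator_def)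
    qed measurable
    then show "(LINT \<omega>|Q. indicator B' \<omega> * (- \<zeta> \<omega> $ j - (- bid t \<omega> $ j))) \<le> 0"
    proof (subst Q_integral)
      have "fst (Z \<omega>) / c * (indicator B' \<omega> * (- \<zeta> \<omega> $ j - (- bid t \<omega> $ j)))
          = (Z \<omega> \<bullet> (- H t \<omega> (?f' \<omega>), ?f' \<omega>)) / c" for \<omega>
        using Z_pos[of \<omega>] c
        unfolding H by (simp add: \<zeta>_def inner_prod_def inner_axis field_simps)
      then show "(LINT \<omega>|N. fst (Z \<omega>) / c * (indicator B' \<omega> * (- \<zeta> \<omega> $ j - (- bid t \<omega> $ j)))) \<le> 0"
        if "(LINT \<omega>|N. Z \<omega> \<bullet> (- H t \<omega> (?f' \<omega>), ?f' \<omega>)) \<le> 0"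
        using that c by (simp add: divide_le_0_iff)
    qed measurable
  qed
  define E where "E t j = real_cond_exp Q (F t) (\<lambda>\<omega>. \<zeta> \<omega> $ j)" for t j
  define X where "X t \<omega> = (\<chi> j. E t j \<omega>)" for t \<omega>
  have X_sum: "X t = (\<lambda>\<omega>. \<Sum>j\<in>UNIV. E t j \<omega> *\<^sub>R axis j 1)" for t
    by (simp add: X_def fun_eq_iff vec_eq_iff axis_def if_distrib[of "\<lambda>x. _ * x"] cong: if_cong)
  have X_measurable: "X t \<in> borel_measurable (F t)" for t
    unfolding X_sum E_def by measurable
  have between: "AE \<omega> in M. \<forall>j\<in>UNIV. bid t \<omega> $ j \<le> E t j \<omega> \<and> E t j \<omega> \<le> ask t \<omega> $ j" if t: "t \<le> T" for t
  proof (intro AE_finite_allI)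
    fix j :: 'n
    interpret S: finite_measure_subalgebra Q "F t" by (rule Q.finite_subalgebra[OF t])
    have [measurable]: "ask t \<in> borel_measurable (F t)" "bid t \<in> borel_measurable (F t)"
      using ask_measurable bid_measurable t by auto
    have "AE \<omega> in Q. E t j \<omega> \<le> ask t \<omega> $ j"
      unfolding E_def
      by (rule S.real_cond_exp_le_of_set_integral_le[OF \<zeta>_int])
        (measurable, rule trade_le(1)[OF t _ _ sets.empty_sets], auto)
    \<comment> \<open>The lower bound by the bid is an upper bound for the negated quotient.\<close>
    moreover have "AE \<omega> in Q. real_cond_exp Q (F t) (\<lambda>\<omega>. - \<zeta> \<omega> $ j) \<omega> \<le> - bid t \<omega> $ j"
      by (rule S.real_cond_exp_le_of_set_integral_le)
        (simp add: \<zeta>_int, measurable, rule trade_le(2)[OF t sets.empty_sets], auto)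
    moreover have "AE \<omega> in Q. real_cond_exp Q (F t) (\<lambda>\<omega>. - \<zeta> \<omega> $ j) \<omega> = - E t j \<omega>"
      using S.real_cond_exp_cmult[OF \<zeta>_int[of j], of "-1"] by (simp add: E_def)
    ultimately have "AE \<omega> in Q. bid t \<omega> $ j \<le> E t j \<omega> \<and> E t j \<omega> \<le> ask t \<omega> $ j"
      by eventually_elim simp
    then show "AE \<omega> in M. bid t \<omega> $ j \<le> E t j \<omega> \<and> E t j \<omega> \<le> ask t \<omega> $ j"
      by (simp add: AE_Q)
  qed simp
  have mart: "martingale_upto Q F T X"
    unfolding martingale_upto_def
  proof (intro conjI allI impI)
    show "integrable Q (X t)" if "t \<le> T" for t
    proof -
      interpret S: finite_measure_subalgebra Q "F t" by (rule Q.finite_subalgebra[OF that])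
      show ?thesis
        unfolding X_sum E_def
        by (intro Bochner_Integration.integrable_sum integrable_scaleR_left S.real_cond_exp_int \<zeta>_int)
    qed
    show "AE \<omega> in Q. real_cond_exp Q (F s) (\<lambda>\<omega>. X t \<omega> $ j) \<omega> = X s \<omega> $ j" if "t \<le> T" "s \<le> t" for t s j
    proof -
      interpret S: finite_measure_subalgebra Q "F s" using that by (intro Q.finite_subalgebra) simp
      have "subalgebra (F t) (F s)"
        using sets_F_mono[OF \<open>s \<le> t\<close>] space_F by (simp add: subalgebra_def)
      from S.real_cond_exp_nested_subalg[OF Q.subalgebra_F[OF \<open>t \<le> T\<close>] this \<zeta>_int]
      show ?thesis by (simp add: X_def E_def)
    qed
  qed (rule X_measurable)
  \<comment> \<open>Subtracting the accumulated dividends from the cum-dividend martingale gives the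
    ex-dividend price.\<close>
  have "consistent_pricing_system Q (\<lambda>t \<omega>. X t \<omega> - gain t \<omega>) (discounted (increment Aask)) X"
    unfolding consistent_pricing_system_def
  proof (intro conjI allI impI ballI)
    show "(\<lambda>\<omega>. X t \<omega> - gain t \<omega>) \<in> borel_measurable (F t)" if "t \<le> T" for t
      using X_measurable gain_measurable[OF that] by measurable
    show "AE \<omega> in M. discounted Pbid t \<omega> \<le> X t \<omega> - gain t \<omega> \<and> X t \<omega> - gain t \<omega> \<le> discounted Pask t \<omega>"
      if "t \<le> T" for t
      using between[OF that]
      by eventually_elim (auto simp: less_eq_vec_def X_def bid_def ask_def le_diff_eq diff_le_eq)
    show "AE \<omega> in M. discounted (increment Aask) t \<omega> \<le> discounted (increment Aask) t \<omega> \<and>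
        discounted (increment Aask) t \<omega> \<le> discounted (increment Abid) t \<omega>" if "t \<in> {1..T}" for t
      using AE_regular by eventually_elim (use that in \<open>auto simp: discounted_def regular_increment\<close>)
    show "AE \<omega> in M. X t \<omega> = X t \<omega> - gain t \<omega> + (\<Sum>u=1..t. discounted (increment Aask) u \<omega>)" for t
      by (simp add: gain_def)
  qed (auto intro: Q_pricing mart discounted_dividend_measurable)
  then show ?thesis by blast
qed

end

theorem theorem4p3:
  fixes M :: "'a measure" and F :: "nat \<Rightarrow> 'a measure" and T :: nat
    and r :: "nat \<Rightarrow> 'a \<Rightarrow> real"
    and Pask Pbid Aask Abid :: "nat \<Rightarrow> 'a \<Rightarrow> real ^ 'n"
  assumes market: "dividend_market M F T r Pask Pbid Aask Abid"
    and savings_0: "AE \<omega> in M. dividend_market.savings r 0 \<omega> = 1"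
    and EF: "dividend_market.efficient_friction M F T r Pask Pbid Aask Abid"
    and same_dividends: "\<And>t. 1 \<le> t \<Longrightarrow> t \<le> T \<Longrightarrow> AE \<omega> in M. Aask t \<omega> = Abid t \<omega>"
  shows "(\<exists>Q P A X. dividend_market.consistent_pricing_system M F T r Pask Pbid Aask Abid Q P A X)
         \<longleftrightarrow> dividend_market.NAEF M F T r Pask Pbid Aask Abid"
proof -
  interpret dividend_market M F T r Pask Pbid Aask Abid by (rule market)
  interpret common_dividend_market M F T r Pask Pbid Aask Abid
    by unfold_locales (use savings_0 same_dividends in auto)
  \<comment> \<open>A pricing system yields NA; the EF half of \<open>NAEF\<close> is the standing
    assumption.\<close>
  show ?thesis
    using EF no_arbitrage_of_pricing_system pricing_system_exists unfolding NAEF_def by blast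
qed

end
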